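(* Let $P\subset\mathbb{R}^3$ be a lattice $3$-polytope of width $1$ and let $k\ge 2$ be an integer. Then the dilation $kP$ has a unimodular cover.
   Context: The lattice is $\mathbb{Z}^3\subset\mathbb{R}^3$. A lattice polytope is the convex hull of finitely many lattice points; a lattice $3$-polytope is a $3$-dimensional lattice polytope. A lattice polytope has width $1$ if its vertices lie in two consecutive parallel lattice hyperplanes, i.e. there are a primitive integer linear functional $f$ and an integer $c$ such that $f(v)\in\{c,c+1\}$ for every vertex $v$. A unimodular tetrahedron is a lattice tetrahedron whose edge vectors from one vertex form a basis of $\mathbb{Z}^3$ (normalized volume $1$). A unimodular cover of a lattice $3$-polytope is a collection of unimodular tetrahedra whose union equals the polytope. *)

theory Defs
  imports "HOL-Analysis.Analysis"
begin

definition int_lattice :: "(real^3) set" where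
  "int_lattice = {x. \<forall>i. x $ i \<in> \<int>}"

definition lattice_polytope :: "(real^3) set \<Rightarrow> bool" where
  "lattice_polytope P \<longleftrightarrow>
     (\<exists>V. finite V \<and> V \<subseteq> int_lattice \<and> P = convex hull V)"

definition lattice_3_polytope :: "(real^3) set \<Rightarrow> bool" where
  "lattice_3_polytope P \<longleftrightarrow> lattice_polytope P \<and> aff_dim P = 3"

text \<open>An integer linear functional is represented by its coefficient vector; it is
  primitive iff its coefficients have greatest common divisor 1.\<close>

definition primitive :: "int^3 \<Rightarrow> bool" where
  "primitive f \<longleftrightarrow> Gcd (range (($) f)) = 1"

definition int_functional :: "int^3 \<Rightarrow> real^3 \<Rightarrow> real" where
  "int_functional f x = (\<Sum>i\<in>UNIV. of_int (f $ i) * x $ i)"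

text \<open>A 3-dimensional polytope cannot have all its vertices in a single hyperplane, so for
  such a polytope the two values below are automatically both attained.\<close>

definition width_one :: "(real^3) set \<Rightarrow> bool" where
  "width_one P \<longleftrightarrow>
     (\<exists>f c. primitive f \<and>
        (\<forall>v. v extreme_point_of P \<longrightarrow> int_functional f v \<in> {of_int c, of_int (c + 1)}))"

definition lattice_basis :: "(3 \<Rightarrow> real^3) \<Rightarrow> bool" where
  "lattice_basis b \<longleftrightarrow>
     (\<forall>i. b i \<in> int_lattice) \<and>
     (\<forall>z\<in>int_lattice. \<exists>!n :: int^3. z = (\<Sum>i\<in>UNIV. of_int (n $ i) *\<^sub>R b i))"

definition unimodular_tetrahedron :: "(real^3) set \<Rightarrow> bool" where
  "unimodular_tetrahedron T \<longleftrightarrow>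
     (\<exists>v b. v \<in> int_lattice \<and> lattice_basis b \<and>
        T = convex hull (insert v (range (\<lambda>i. v + b i))))"

text \<open>Tetrahedra of a cover may overlap. Finiteness need not be required: a bounded set
  contains only finitely many lattice tetrahedra.\<close>

definition unimodular_cover :: "(real^3) set set \<Rightarrow> (real^3) set \<Rightarrow> bool" where
  "unimodular_cover C P \<longleftrightarrow> (\<forall>T\<in>C. unimodular_tetrahedron T) \<and> \<Union>C = P"

end

theory Submission
  imports Defs
begin

text \<open>
  The family of all unimodular tetrahedra contained in \<open>kP\<close> has union \<open>kP\<close>: every point of
  \<open>kP\<close> lies in one of them.

  First (\<open>edge_cell_exists\<close>, \<open>edge_cell_primitive\<close>), every point of \<open>P\<close> lies in a lattice
  tetrahedron \<open>T\<close> in \<open>P\<close> that is spanned by two primitive segments in consecutive lattice planes,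
  \<open>[a, a + u]\<close> and \<open>[a + e, a + e + v]\<close>. By Caratheodory's theorem the point lies in a
  nondegenerate tetrahedron whose vertices are vertices of \<open>P\<close>, hence lie in two consecutive
  lattice planes. If they are distributed as three and one, the lattice points of the triangle allow
  one to pass to a unimodular tetrahedron (\<open>triangle_refine\<close>), any two opposite edges of which lie
  in consecutive lattice planes. If they are distributed as two and two, the tetrahedron is cut at an
  interior lattice point of one of the two segments as long as there is one.

  It remains to cover \<open>kT\<close> for \<open>k \<ge> 2\<close> (\<open>edge_simplex_cover\<close>). In the coordinates
  \<open>(x, y, h)\<close> given by \<open>ka + x u + y v + h e\<close>, the set \<open>kT\<close> is
  \<open>0 \<le> h \<le> k, 0 \<le> x \<le> k - h, 0 \<le> y \<le> h\<close>. The layer \<open>i \<le> h \<le> i + 1\<close> is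
  the convex hull of two parallelograms, with sides \<open>(k - i) u, i v\<close> at height \<open>i\<close> and
  \<open>(k - i - 1) u, (i + 1) v\<close> at height \<open>i + 1\<close>.

  If the upper parallelogram is nondegenerate (\<open>i \<le> k - 2\<close>) and \<open>h = i + t\<close> with
  \<open>t \<ge> 1/2\<close>, the point lies in a pyramid over a unit cell of the upper parallelogram with
  apex a lattice point of the lower one: in the section at that height the pyramids with
  a common apex fill a copy of the upper parallelogram scaled by \<open>t\<close>, and the apexes shift this copy in
  steps of \<open>1 - t \<le> t\<close>, so that there are no gaps. Such a pyramid consists of two
  tetrahedra of the three-and-one kind, which are already dealt with (\<open>upper_half_cover\<close>). The
  case \<open>t \<le> 1/2\<close>, \<open>i \<ge> 1\<close> follows by exchanging the two segments.

  In the bottom layer \<open>i = 0\<close> the lower parallelogram degenerates to the segment \<open>[0, k] u\<close>, and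
  the upper one has sides at least \<open>u\<close> and \<open>v\<close>, because \<open>k \<ge> 2\<close>. Complete \<open>u\<close> to a basis
  \<open>u, w\<close> of its lattice plane and join lattice points, one in each row \<open>j w + \<real> u\<close>, to a path
  across the parallelogram spanned by \<open>u\<close> and \<open>v\<close>. A step of the path and a unit step of the
  bottom segment span a unimodular tetrahedron; what these tetrahedra miss lies in the pyramids over
  the cells with apex at one of the two ends of the bottom segment (\<open>bottom_cover\<close>). The top
  layer is symmetric.
\<close>

section \<open>Lattice bases and determinants\<close>

text \<open>The determinant of the matrix with rows \<open>a, b, c\<close>.\<close>

abbreviation det3 :: "real^3 \<Rightarrow> real^3 \<Rightarrow> real^3 \<Rightarrow> real" where
  "det3 a b c \<equiv> det (vector [a, b, c] :: real^3^3)"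

text \<open>A linear functional that is integral on the lattice; unlike a coefficient vector, it can be
  produced directly from the coordinates with respect to any lattice basis.\<close>

definition integral_form :: "(real^3 \<Rightarrow> real) \<Rightarrow> bool" where
  "integral_form f \<longleftrightarrow> linear f \<and> (\<forall>z\<in>int_lattice. f z \<in> \<int>)"

text \<open>Three vectors forming a basis of the lattice. Uniqueness of the coefficients is replaced by a
  nonzero determinant.\<close>

definition basis3 :: "real^3 \<Rightarrow> real^3 \<Rightarrow> real^3 \<Rightarrow> bool" where
  "basis3 a b c \<longleftrightarrow> a \<in> int_lattice \<and> b \<in> int_lattice \<and> c \<in> int_lattice \<and> det3 a b c \<noteq> 0 \<and>
     (\<forall>z\<in>int_lattice. \<exists>l m n :: int. z = of_int l *\<^sub>R a + of_int m *\<^sub>R b + of_int n *\<^sub>R c)"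

text \<open>The point \<open>x\<close> lies in some unimodular tetrahedron contained in \<open>K\<close>.\<close>

definition covered :: "(real^3) set \<Rightarrow> real^3 \<Rightarrow> bool" where
  "covered K x \<longleftrightarrow> (\<exists>T. unimodular_tetrahedron T \<and> x \<in> T \<and> T \<subseteq> K)"

lemma int_lattice_add: "a \<in> int_lattice \<Longrightarrow> b \<in> int_lattice \<Longrightarrow> a + b \<in> int_lattice"
  and int_lattice_diff: "a \<in> int_lattice \<Longrightarrow> b \<in> int_lattice \<Longrightarrow> a - b \<in> int_lattice"
  and int_lattice_minus: "a \<in> int_lattice \<Longrightarrow> - a \<in> int_lattice"
  and int_lattice_scale: "a \<in> int_lattice \<Longrightarrow> of_int n *\<^sub>R a \<in> int_lattice"
  by (auto simp: int_lattice_def)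

lemmas int_lattice_intros = int_lattice_add int_lattice_diff int_lattice_minus int_lattice_scale

lemma det3_Ints:
  assumes "a \<in> int_lattice" "b \<in> int_lattice" "c \<in> int_lattice"
  shows "det3 a b c \<in> \<int>"
  using assms unfolding int_lattice_def det_3 vector_3 by (intro Ints_add Ints_diff Ints_mult) auto

text \<open>The inductions below are on the absolute value of an integral determinant.\<close>

lemma det3_descent:
  assumes "a \<in> int_lattice" "b \<in> int_lattice" "c \<in> int_lattice"
    and "a' \<in> int_lattice" "b' \<in> int_lattice" "c' \<in> int_lattice"
    and "\<bar>det3 a' b' c'\<bar> < \<bar>det3 a b c\<bar>"
  shows "nat \<lfloor>\<bar>det3 a' b' c'\<bar>\<rfloor> < nat \<lfloor>\<bar>det3 a b c\<bar>\<rfloor>"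
proof -
  have "det3 a' b' c' \<in> \<int>" "det3 a b c \<in> \<int>" using det3_Ints assms by auto
  then obtain m n :: int where "det3 a' b' c' = of_int m" "det3 a b c = of_int n"
    by (metis Ints_cases)
  then show ?thesis using assms(7) by (simp flip: of_int_abs)
qed

lemma det3_cramer:
  "det3 a b c *\<^sub>R z = det3 z b c *\<^sub>R a + det3 a z c *\<^sub>R b + det3 a b z *\<^sub>R c"
  by (simp add: vec_eq_iff forall_3 det_3 vector_3 algebra_simps)

lemma det3_combination:
  "det3 (x *\<^sub>R a + y *\<^sub>R b + z *\<^sub>R c) b c = x * det3 a b c"
  "det3 a (x *\<^sub>R a + y *\<^sub>R b + z *\<^sub>R c) c = y * det3 a b c"
  "det3 a b (x *\<^sub>R a + y *\<^sub>R b + z *\<^sub>R c) = z * det3 a b c"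
  by (simp_all add: det_3 vector_3 algebra_simps)

lemma det3_coordinates:
  assumes "det3 a b c \<noteq> 0"
  obtains x y w where "z = x *\<^sub>R a + y *\<^sub>R b + w *\<^sub>R c"
proof
  have "z = (1 / det3 a b c) *\<^sub>R (det3 a b c *\<^sub>R z)" using assms by simp
  also have "\<dots> = (det3 z b c / det3 a b c) *\<^sub>R a + (det3 a z c / det3 a b c) *\<^sub>R b
      + (det3 a b z / det3 a b c) *\<^sub>R c"
    unfolding det3_cramer[of a b c z] by (simp add: scaleR_add_right)
  finally show "z = (det3 z b c / det3 a b c) *\<^sub>R a + (det3 a z c / det3 a b c) *\<^sub>R b
      + (det3 a b z / det3 a b c) *\<^sub>R c" .
qed

lemma det3_coordinates_unique:
  assumes "det3 a b c \<noteq> 0"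
    and "x *\<^sub>R a + y *\<^sub>R b + z *\<^sub>R c = x' *\<^sub>R a + y' *\<^sub>R b + z' *\<^sub>R c"
  shows "x = x'" "y = y'" "z = z'"
proof -
  note l = det3_combination[where x=x and y=y and z=z and a=a and b=b and c=c]
  note r = det3_combination[where x=x' and y=y' and z=z' and a=a and b=b and c=c]
  show "x = x'" using l(1) r(1) assms(1) unfolding assms(2) by (metis mult_right_cancel)
  show "y = y'" using l(2) r(2) assms(1) unfolding assms(2) by (metis mult_right_cancel)
  show "z = z'" using l(3) r(3) assms(1) unfolding assms(2) by (metis mult_right_cancel)
qed

lemma det3_swap: "det3 b a c = - det3 a b c"
  by (simp add: det_3 vector_3 algebra_simps)

lemma convex_comb4:
  assumes "convex K" "p \<in> K" "q \<in> K" "r \<in> K" "s \<in> K"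
    and "0 \<le> a" "0 \<le> b" "0 \<le> c" "0 \<le> d" "a + b + c + d = 1"
  shows "a *\<^sub>R p + b *\<^sub>R q + c *\<^sub>R r + d *\<^sub>R s \<in> K"
proof -
  have "(\<Sum>i\<in>{0,1,2,3::nat}. ([a,b,c,d] ! i) *\<^sub>R ([p,q,r,s] ! i)) \<in> K"
    using assms by (intro convex_sum) (auto simp: eval_nat_numeral)
  then show ?thesis by (simp add: eval_nat_numeral add.assoc)
qed

lemma convex_simplex_mem:
  assumes "convex K" "p \<in> K" "p + a \<in> K" "p + b \<in> K" "p + c \<in> K"
    and "0 \<le> x" "0 \<le> y" "0 \<le> z" "x + y + z \<le> 1"
  shows "p + x *\<^sub>R a + y *\<^sub>R b + z *\<^sub>R c \<in> K"
proof -
  have "(1 - x - y - z) *\<^sub>R p + x *\<^sub>R (p + a) + y *\<^sub>R (p + b) + z *\<^sub>R (p + c) \<in> K"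
    using assms by (intro convex_comb4) auto
  also have "(1 - x - y - z) *\<^sub>R p + x *\<^sub>R (p + a) + y *\<^sub>R (p + b) + z *\<^sub>R (p + c)
    = p + x *\<^sub>R a + y *\<^sub>R b + z *\<^sub>R c" by (simp add: algebra_simps)
  finally show ?thesis .
qed

lemma basis3_unimodular:
  assumes "basis3 a b c" "p \<in> int_lattice"
  shows "unimodular_tetrahedron (convex hull {p, p + a, p + b, p + c})"
proof -
  let ?b = "\<lambda>i::3. (vector [a,b,c] :: real^3^3) $ i"
  have "lattice_basis ?b" unfolding lattice_basis_def
  proof (intro conjI ballI)
    show "\<forall>i. ?b i \<in> int_lattice" using assms by (simp add: forall_3 basis3_def)
    fix z assume "z \<in> int_lattice"
    then obtain l m n :: int where z: "z = of_int l *\<^sub>R a + of_int m *\<^sub>R b + of_int n *\<^sub>R c"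
      using assms unfolding basis3_def by blast
    have D: "det3 a b c \<noteq> 0" using assms by (simp add: basis3_def)
    show "\<exists>!n::int^3. z = (\<Sum>i\<in>UNIV. of_int (n $ i) *\<^sub>R ?b i)"
    proof (rule ex1I[of _ "vector [l,m,n]"])
      show "z = (\<Sum>i\<in>UNIV. of_int ((vector [l,m,n] :: int^3) $ i) *\<^sub>R ?b i)"
        by (simp add: sum_3 z)
      fix k :: "int^3" assume "z = (\<Sum>i\<in>UNIV. of_int (k $ i) *\<^sub>R ?b i)"
      then have e: "of_int (k$1) *\<^sub>R a + of_int (k$2) *\<^sub>R b + of_int (k$3) *\<^sub>R c =
        of_int l *\<^sub>R a + of_int m *\<^sub>R b + of_int n *\<^sub>R c" by (simp add: sum_3 z)
      show "k = vector [l,m,n]"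
        using det3_coordinates_unique[OF D e] by (simp add: vec_eq_iff forall_3)
    qed
  qed
  moreover have "range (\<lambda>i. p + ?b i) = {p + a, p + b, p + c}"
    by (auto simp: UNIV_3)
  ultimately show ?thesis using assms(2) unfolding unimodular_tetrahedron_def
    by (intro exI[of _ p] exI[of _ ?b]) simp
qed

lemma covered_basis3:
  assumes "basis3 a b c" "p \<in> int_lattice" "convex K" "p \<in> K" "p + a \<in> K" "p + b \<in> K" "p + c \<in> K"
    and "0 \<le> x" "0 \<le> y" "0 \<le> z" "x + y + z \<le> 1"
  shows "covered K (p + x *\<^sub>R a + y *\<^sub>R b + z *\<^sub>R c)"
  unfolding covered_def
proof (intro exI conjI)
  let ?T = "convex hull {p, p + a, p + b, p + c}"
  show "unimodular_tetrahedron ?T" using assms by (intro basis3_unimodular)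
  show "?T \<subseteq> K" using assms by (intro hull_minimal) auto
  have "{p, p + a, p + b, p + c} \<subseteq> ?T" by (rule hull_subset)
  then show "p + x *\<^sub>R a + y *\<^sub>R b + z *\<^sub>R c \<in> ?T"
    using assms by (intro convex_simplex_mem) auto
qed

lemma integral_form_combination:
  assumes "integral_form f"
  shows "f (x *\<^sub>R a + y *\<^sub>R b + z *\<^sub>R c) = x * f a + y * f b + z * f c"
    "f (a + b) = f a + f b" "f (a - b) = f a - f b" "f (- a) = - f a" "f (x *\<^sub>R a) = x * f a"
  using assms unfolding integral_form_def
  by (auto simp: linear_add linear_diff linear_cmul linear_neg)

section \<open>Refining a lattice triangle in a lattice plane\<close>

text \<open>If three lattice points of the plane \<open>f = 1\<close> do not form a lattice basis, their triangle contains a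
  further lattice point. The fractional parts of the coordinates of a lattice vector sum to an
  integer, because \<open>f\<close> is integral. If the sum is 1 they are the barycentric coordinates of the
  required point; if it is 2, their complements to 1 are.\<close>

lemma triangle_lattice_point:
  assumes L: "a \<in> int_lattice" "b \<in> int_lattice" "c \<in> int_lattice"
    and f: "integral_form f" "f a = 1" "f b = 1" "f c = 1"
    and D: "det3 a b c \<noteq> 0" and nb: "\<not> basis3 a b c"
  obtains x y z where "0 \<le> x" "x < 1" "0 \<le> y" "y < 1" "0 \<le> z" "z < 1" "x + y + z = 1"
    "x *\<^sub>R a + y *\<^sub>R b + z *\<^sub>R c \<in> int_lattice"
proof -
  obtain w where w: "w \<in> int_lattice"
    and nw: "\<And>l m n::int. w \<noteq> of_int l *\<^sub>R a + of_int m *\<^sub>R b + of_int n *\<^sub>R c"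
    using nb L D unfolding basis3_def by blast
  obtain x y z where xyz: "w = x *\<^sub>R a + y *\<^sub>R b + z *\<^sub>R c"
    using det3_coordinates[OF D] .
  define v where "v = frac x *\<^sub>R a + frac y *\<^sub>R b + frac z *\<^sub>R c"
  have "v = w - (of_int \<lfloor>x\<rfloor> *\<^sub>R a + of_int \<lfloor>y\<rfloor> *\<^sub>R b + of_int \<lfloor>z\<rfloor> *\<^sub>R c)"
    unfolding v_def xyz by (simp add: frac_def algebra_simps)
  then have v: "v \<in> int_lattice" using w L by (auto intro!: int_lattice_intros)
  have fv: "f v = frac x + frac y + frac z"
    unfolding v_def integral_form_combination[OF f(1)] f by simp
  moreover have "f v \<in> \<int>" using f v unfolding integral_form_def by blast
  ultimately obtain n :: int where n: "frac x + frac y + frac z = of_int n"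
    by (metis Ints_cases)
  have fr: "0 \<le> frac x" "frac x < 1" "0 \<le> frac y" "frac y < 1" "0 \<le> frac z" "frac z < 1"
    by (auto simp: frac_lt_1)
  \<comment> \<open>Otherwise all three coordinates would be integers.\<close>
  have "n \<noteq> 0"
  proof
    assume "n = 0"
    then have "frac x = 0" "frac y = 0" "frac z = 0" using n fr by linarith+
    then have "x = of_int \<lfloor>x\<rfloor>" "y = of_int \<lfloor>y\<rfloor>" "z = of_int \<lfloor>z\<rfloor>"
      by (auto simp: frac_def)
    then show False using nw xyz by metis
  qed
  moreover have "0 \<le> n" "n < 3" using n fr by linarith+
  ultimately consider "n = 1" | "n = 2" by linarith
  then show thesis
  proof cases
    case 1
    show thesis using that[OF fr] n 1 v unfolding v_def by simp
  next
    case 2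
    have "a + b + c - v = (1 - frac x) *\<^sub>R a + (1 - frac y) *\<^sub>R b + (1 - frac z) *\<^sub>R c"
      unfolding v_def by (simp add: algebra_simps)
    moreover have "a + b + c - v \<in> int_lattice" using v L by (intro int_lattice_intros)
    ultimately show thesis
      using that[of "1 - frac x" "1 - frac y" "1 - frac z"] n 2 fr by (simp del: frac_gt_0_iff)
  qed
qed

text \<open>\<open>a', b', c'\<close> are lattice points of the triangle \<open>a, b, c\<close> in the plane \<open>f = 1\<close>.\<close>

definition subtriangle where
  "subtriangle f a b c a' b' c' \<longleftrightarrow>
    {a', b', c'} \<subseteq> int_lattice \<inter> convex hull {a, b, c} \<and> f a' = 1 \<and> f b' = 1 \<and> f c' = (1::real)"

text \<open>Replacing the vertex \<open>a\<close> by a point \<open>w\<close> of the triangle with barycentric coordinates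
  \<open>x, y, z\<close> multiplies the determinant by \<open>x\<close>. A point \<open>\<alpha> a + \<beta> b + \<gamma> c\<close> of the cone stays in
  the new cone if the ratio \<open>\<alpha> / x\<close> is the smallest of the three.\<close>

lemma exchange_vertex:
  fixes a b c :: "real^3"
  assumes w: "w = x *\<^sub>R a + y *\<^sub>R b + z *\<^sub>R c" "0 < x" "x < 1"
    and D: "det3 a b c \<noteq> 0"
    and nn: "0 \<le> \<alpha>" "0 \<le> \<beta>" "0 \<le> \<gamma>"
    and le: "\<alpha> * y \<le> \<beta> * x" "\<alpha> * z \<le> \<gamma> * x"
  shows "\<exists>\<alpha>' \<beta>' \<gamma>'. 0 \<le> \<alpha>' \<and> 0 \<le> \<beta>' \<and> 0 \<le> \<gamma>' \<and>
     \<alpha>' *\<^sub>R w + \<beta>' *\<^sub>R b + \<gamma>' *\<^sub>R c = \<alpha> *\<^sub>R a + \<beta> *\<^sub>R b + \<gamma> *\<^sub>R c"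
    and "det3 w b c \<noteq> 0" "\<bar>det3 w b c\<bar> < \<bar>det3 a b c\<bar>"
proof -
  show "det3 w b c \<noteq> 0" unfolding w(1) det3_combination using w D by simp
  show "\<bar>det3 w b c\<bar> < \<bar>det3 a b c\<bar>"
    unfolding w(1) det3_combination abs_mult using w D by simp
  have "(\<alpha>/x) *\<^sub>R w + (\<beta> - \<alpha>*y/x) *\<^sub>R b + (\<gamma> - \<alpha>*z/x) *\<^sub>R c = \<alpha> *\<^sub>R a + \<beta> *\<^sub>R b + \<gamma> *\<^sub>R c"
    unfolding w(1) using w(2) by (simp add: algebra_simps)
  moreover have "0 \<le> \<alpha>/x" "0 \<le> \<beta> - \<alpha>*y/x" "0 \<le> \<gamma> - \<alpha>*z/x"
    using nn le w(2) by (auto simp: field_simps)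
  ultimately show "\<exists>\<alpha>' \<beta>' \<gamma>'. 0 \<le> \<alpha>' \<and> 0 \<le> \<beta>' \<and> 0 \<le> \<gamma>' \<and>
     \<alpha>' *\<^sub>R w + \<beta>' *\<^sub>R b + \<gamma>' *\<^sub>R c = \<alpha> *\<^sub>R a + \<beta> *\<^sub>R b + \<gamma> *\<^sub>R c"
    by blast
qed

text \<open>One of the three ratios with positive denominator \<open>\<alpha> / x\<close>, \<open>\<beta> / y\<close>, \<open>\<gamma> / z\<close> is the smallest;
  the inequalities are stated without division to allow zero denominators.\<close>

lemma min_ratio:
  fixes x y z \<alpha> \<beta> \<gamma> :: real
  assumes "0 \<le> x" "0 \<le> y" "0 \<le> z" "x + y + z = 1" "0 \<le> \<alpha>" "0 \<le> \<beta>" "0 \<le> \<gamma>"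
  shows "0 < x \<and> \<alpha> * y \<le> \<beta> * x \<and> \<alpha> * z \<le> \<gamma> * x \<or>
    0 < y \<and> \<beta> * x \<le> \<alpha> * y \<and> \<beta> * z \<le> \<gamma> * y \<or>
    0 < z \<and> \<gamma> * y \<le> \<beta> * z \<and> \<gamma> * x \<le> \<alpha> * z"
proof -
  define I where "I = {(x, \<alpha>), (y, \<beta>), (z, \<gamma>)}"
  define J where "J = {p\<in>I. fst p > 0}"
  have fin: "finite J" unfolding J_def I_def by simp
  have ne: "J \<noteq> {}"
  proof -
    have "0 < x \<or> 0 < y \<or> 0 < z" using assms by linarith
    then show ?thesis unfolding J_def I_def by auto
  qed
  define p where "p = arg_min_on (\<lambda>p. snd p / fst p) J"
  have p: "p \<in> J" and min: "\<And>q. q \<in> J \<Longrightarrow> snd p / fst p \<le> snd q / fst q"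
    using arg_min_if_finite[OF fin ne, of "\<lambda>p. snd p / fst p"]
    unfolding p_def[symmetric] by (auto simp: not_less)
  have "snd p * fst q \<le> snd q * fst p" if "q \<in> I" for q
  proof (cases "fst q > 0")
    case True
    then show ?thesis using min[of q] that p by (simp add: J_def field_simps)
  next
    case False
    then have "fst q = 0" "snd q \<ge> 0" using that assms unfolding I_def by auto
    then show ?thesis using p by (simp add: J_def)
  qed
  then have "snd p * y \<le> \<beta> * fst p" "snd p * x \<le> \<alpha> * fst p" "snd p * z \<le> \<gamma> * fst p"
    unfolding I_def by force+
  moreover have "0 < fst p" "p = (x, \<alpha>) \<or> p = (y, \<beta>) \<or> p = (z, \<gamma>)"
    using p unfolding J_def I_def by blast+
  ultimately show ?thesis by (elim disjE) simp_all
qed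

lemma triangle_refine_step:
  assumes L: "a \<in> int_lattice" "b \<in> int_lattice" "c \<in> int_lattice"
    and f: "integral_form f" "f a = 1" "f b = 1" "f c = 1"
    and D: "det3 a b c \<noteq> 0" and nb: "\<not> basis3 a b c"
    and nn: "0 \<le> \<alpha>" "0 \<le> \<beta>" "0 \<le> \<gamma>"
  shows "\<exists>a' b' c' \<alpha>' \<beta>' \<gamma>'. subtriangle f a b c a' b' c' \<and>
     det3 a' b' c' \<noteq> 0 \<and> \<bar>det3 a' b' c'\<bar> < \<bar>det3 a b c\<bar> \<and> 0 \<le> \<alpha>' \<and> 0 \<le> \<beta>' \<and> 0 \<le> \<gamma>' \<and>
     \<alpha>' *\<^sub>R a' + \<beta>' *\<^sub>R b' + \<gamma>' *\<^sub>R c' = \<alpha> *\<^sub>R a + \<beta> *\<^sub>R b + \<gamma> *\<^sub>R c"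
proof -
  obtain x y z where xyz: "0 \<le> x" "x < 1" "0 \<le> y" "y < 1" "0 \<le> z" "z < 1" "x + y + z = 1"
    "x *\<^sub>R a + y *\<^sub>R b + z *\<^sub>R c \<in> int_lattice"
    using triangle_lattice_point[OF L f D nb] .
  define w where "w = x *\<^sub>R a + y *\<^sub>R b + z *\<^sub>R c"
  have fw: "f w = 1" unfolding w_def integral_form_combination[OF f(1)] f using xyz by simp
  have hull: "{a,b,c} \<subseteq> convex hull {a,b,c}" by (rule hull_subset)
  have "w + 0 *\<^sub>R a \<in> convex hull {a,b,c}"
    unfolding w_def using xyz hull by (intro convex_comb4) auto
  then have wL: "w \<in> convex hull {a,b,c}" "w \<in> int_lattice" using xyz by (auto simp: w_def)
  consider "0 < x" "\<alpha> * y \<le> \<beta> * x" "\<alpha> * z \<le> \<gamma> * x"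
    | "0 < y" "\<beta> * x \<le> \<alpha> * y" "\<beta> * z \<le> \<gamma> * y"
    | "0 < z" "\<gamma> * y \<le> \<beta> * z" "\<gamma> * x \<le> \<alpha> * z"
    using min_ratio[OF xyz(1,3,5,7) nn] by blast
  then show ?thesis
  proof cases
    case 1
    note exchange_vertex[OF w_def 1(1) xyz(2) D nn 1(2,3)]
    moreover have "subtriangle f a b c w b c"
      using f fw wL L hull unfolding subtriangle_def by simp
    ultimately show ?thesis by blast
  next
    case 2
    have w': "w = y *\<^sub>R b + x *\<^sub>R a + z *\<^sub>R c" unfolding w_def by simp
    have D': "det3 b a c \<noteq> 0" using D by (simp add: det3_swap[of b])
    note exchange_vertex[OF w' 2(1) xyz(4) D' nn(2,1,3) 2(2,3)]
    moreover have "subtriangle f a b c w a c"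
      using f fw wL L hull unfolding subtriangle_def by simp
    moreover have "\<beta> *\<^sub>R b + \<alpha> *\<^sub>R a + \<gamma> *\<^sub>R c = \<alpha> *\<^sub>R a + \<beta> *\<^sub>R b + \<gamma> *\<^sub>R c"
      by simp
    ultimately show ?thesis unfolding det3_swap[of b a] abs_minus_cancel by metis
  next
    case 3
    have w': "w = z *\<^sub>R c + y *\<^sub>R b + x *\<^sub>R a" unfolding w_def by simp
    have eq: "det3 c b a = - det3 a b c" by (simp add: det_3 vector_3 algebra_simps)
    have D': "det3 c b a \<noteq> 0" using D eq by simp
    note exchange_vertex[OF w' 3(1) xyz(6) D' nn(3,2,1) 3(2,3)]
    moreover have "subtriangle f a b c w b a"
      using f fw wL L hull unfolding subtriangle_def by simp
    moreover have "\<gamma> *\<^sub>R c + \<beta> *\<^sub>R b + \<alpha> *\<^sub>R a = \<alpha> *\<^sub>R a + \<beta> *\<^sub>R b + \<gamma> *\<^sub>R c"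
      by simp
    ultimately show ?thesis unfolding eq abs_minus_cancel by metis
  qed
qed

text \<open>Every point of a cone spanned by three lattice points of the plane \<open>f = 1\<close> lies in the cone
  spanned by a lattice basis that consists of lattice points of the triangle.\<close>

lemma triangle_refine:
  assumes "a \<in> int_lattice" "b \<in> int_lattice" "c \<in> int_lattice"
    and f: "integral_form f" and "f a = 1" "f b = 1" "f c = 1"
    and "det3 a b c \<noteq> 0" and "0 \<le> \<alpha>" "0 \<le> \<beta>" "0 \<le> \<gamma>"
  shows "\<exists>a' b' c' \<alpha>' \<beta>' \<gamma>'. subtriangle f a b c a' b' c' \<and> basis3 a' b' c' \<and>
     0 \<le> \<alpha>' \<and> 0 \<le> \<beta>' \<and> 0 \<le> \<gamma>' \<and>
     \<alpha>' *\<^sub>R a' + \<beta>' *\<^sub>R b' + \<gamma>' *\<^sub>R c' = \<alpha> *\<^sub>R a + \<beta> *\<^sub>R b + \<gamma> *\<^sub>R c"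
  using assms
proof (induction "nat \<lfloor>\<bar>det3 a b c\<bar>\<rfloor>" arbitrary: a b c \<alpha> \<beta> \<gamma> rule: less_induct)
  case less
  show ?case
  proof (cases "basis3 a b c")
    case True
    have "{a,b,c} \<subseteq> convex hull {a,b,c}" by (rule hull_subset)
    then have "subtriangle f a b c a b c" using less.prems by (simp add: subtriangle_def)
    then show ?thesis using True less.prems by blast
  next
    case False
    obtain a' b' c' \<alpha>' \<beta>' \<gamma>' where st: "subtriangle f a b c a' b' c'"
      "det3 a' b' c' \<noteq> 0" "\<bar>det3 a' b' c'\<bar> < \<bar>det3 a b c\<bar>" "0 \<le> \<alpha>'" "0 \<le> \<beta>'" "0 \<le> \<gamma>'"
      and eq: "\<alpha>' *\<^sub>R a' + \<beta>' *\<^sub>R b' + \<gamma>' *\<^sub>R c' = \<alpha> *\<^sub>R a + \<beta> *\<^sub>R b + \<gamma> *\<^sub>R c"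
      using triangle_refine_step[OF less.prems(1-8) False less.prems(9-11)] by blast
    have L: "a' \<in> int_lattice" "b' \<in> int_lattice" "c' \<in> int_lattice" "f a' = 1" "f b' = 1" "f c' = 1"
      and H: "{a', b', c'} \<subseteq> convex hull {a, b, c}"
      using st(1) unfolding subtriangle_def by auto
    have "nat \<lfloor>\<bar>det3 a' b' c'\<bar>\<rfloor> < nat \<lfloor>\<bar>det3 a b c\<bar>\<rfloor>"
      using det3_descent[OF less.prems(1-3) L(1-3) st(3)] .
    from less.hyps[OF this L(1-3) f L(4-6) st(2,4,5,6)]
    obtain a'' b'' c'' \<alpha>'' \<beta>'' \<gamma>'' where s2: "subtriangle f a' b' c' a'' b'' c''"
      and rest: "basis3 a'' b'' c''" "0 \<le> \<alpha>''" "0 \<le> \<beta>''" "0 \<le> \<gamma>''"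
      "\<alpha>'' *\<^sub>R a'' + \<beta>'' *\<^sub>R b'' + \<gamma>'' *\<^sub>R c'' = \<alpha>' *\<^sub>R a' + \<beta>' *\<^sub>R b' + \<gamma>' *\<^sub>R c'"
      by blast
    have "convex hull {a', b', c'} \<subseteq> convex hull {a, b, c}"
      using H by (intro hull_minimal) auto
    then have "subtriangle f a b c a'' b'' c''" using s2 unfolding subtriangle_def by blast
    then show ?thesis using rest eq by metis
  qed
qed

section \<open>Tetrahedra spanned by two edges in consecutive lattice planes\<close>

text \<open>Lattice vectors \<open>u, v\<close> parallel to the lattice planes of \<open>f\<close>, and \<open>e\<close> leading from one such plane to
  the next.\<close>

definition edge_frame where
  "edge_frame f u v e \<longleftrightarrow> integral_form f \<and> u \<in> int_lattice \<and> v \<in> int_lattice \<and> e \<in> int_lattice \<and>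
     f u = 0 \<and> f v = 0 \<and> f e = 1 \<and> det3 u v e \<noteq> 0"

text \<open>There is no lattice point strictly between \<open>0\<close> and \<open>u\<close>.\<close>

definition lattice_primitive :: "real^3 \<Rightarrow> bool" where
  "lattice_primitive u \<longleftrightarrow> (\<forall>s. 0 < s \<and> s < 1 \<longrightarrow> s *\<^sub>R u \<notin> int_lattice)"

text \<open>The tetrahedron with edges \<open>[c, c + k u]\<close> and \<open>[c + k e, c + k e + k v]\<close>, in coordinates with respect
  to \<open>u, v, e\<close>.\<close>

definition edge_simplex :: "real^3 \<Rightarrow> real^3 \<Rightarrow> real^3 \<Rightarrow> real^3 \<Rightarrow> int \<Rightarrow> (real^3) set" where
  "edge_simplex c u v e k = {c + x *\<^sub>R u + y *\<^sub>R v + h *\<^sub>R e | x y h.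
     0 \<le> h \<and> h \<le> of_int k \<and> 0 \<le> x \<and> x \<le> of_int k - h \<and> 0 \<le> y \<and> y \<le> h}"

lemma edge_simplexI:
  "0 \<le> h \<Longrightarrow> h \<le> of_int k \<Longrightarrow> 0 \<le> x \<Longrightarrow> x \<le> of_int k - h \<Longrightarrow> 0 \<le> y \<Longrightarrow> y \<le> h \<Longrightarrow>
   c + x *\<^sub>R u + y *\<^sub>R v + h *\<^sub>R e \<in> edge_simplex c u v e k"
  unfolding edge_simplex_def by blast

text \<open>Reversing the direction of \<open>f\<close> exchanges the roles of the two edges.\<close>

lemma edge_frame_swap:
  assumes "edge_frame f u v e"
  shows "edge_frame (\<lambda>x. - f x) v u (- e)"
proof -
  have "det3 v u (- e) = det3 u v e" by (simp add: det_3 vector_3 algebra_simps)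
  then show ?thesis using assms unfolding edge_frame_def integral_form_def
    by (auto simp: int_lattice_minus linear_neg intro: linear_compose_neg)
qed

lemma edge_simplex_swap:
  "edge_simplex (c + of_int k *\<^sub>R e) v u (- e) k = edge_simplex c u v e k"
proof -
  have sub: "edge_simplex (c + of_int k *\<^sub>R e) v u (- e) k \<subseteq> edge_simplex c u v e k" for c e u v
  proof
    fix z assume "z \<in> edge_simplex (c + of_int k *\<^sub>R e) v u (- e) k"
    then obtain x y h where z: "z = c + of_int k *\<^sub>R e + x *\<^sub>R v + y *\<^sub>R u + h *\<^sub>R (- e)"
      and b: "0 \<le> h" "h \<le> of_int k" "0 \<le> x" "x \<le> of_int k - h" "0 \<le> y" "y \<le> h"
      unfolding edge_simplex_def by blast
    have "z = c + y *\<^sub>R u + x *\<^sub>R v + (of_int k - h) *\<^sub>R e"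
      unfolding z by (simp add: algebra_simps)
    then show "z \<in> edge_simplex c u v e k" using b by (auto intro!: edge_simplexI)
  qed
  show ?thesis using sub[of c e v u] sub[of "c + of_int k *\<^sub>R e" "- e" u v] by auto
qed

lemma frame_det:
  assumes "edge_frame f u v e"
  shows "det3 d u v = f d * det3 u v e"
proof -
  have D: "det3 u v e \<noteq> 0" and I: "integral_form f" using assms unfolding edge_frame_def by auto
  obtain x y z where d: "d = x *\<^sub>R u + y *\<^sub>R v + z *\<^sub>R e" using det3_coordinates[OF D] .
  have "f d = z" using assms unfolding d integral_form_combination[OF I] edge_frame_def by simp
  moreover have "det3 d u v = z * det3 u v e"
    unfolding d by (simp add: det_3 vector_3 algebra_simps)
  ultimately show ?thesis by simp
qed

text \<open>The same for the tetrahedron with apex \<open>p\<close> and opposite face \<open>p + a, p + b, p + c\<close>, which lies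
  in the next lattice plane.\<close>

lemma cone_refine:
  assumes f: "integral_form f" "f a = 1" "f b = 1" "f c = 1"
    and L: "p \<in> int_lattice" "a \<in> int_lattice" "b \<in> int_lattice" "c \<in> int_lattice"
    and D: "det3 a b c \<noteq> 0"
    and K: "convex K" "p \<in> K" "p + a \<in> K" "p + b \<in> K" "p + c \<in> K"
    and nn: "0 \<le> \<alpha>" "0 \<le> \<beta>" "0 \<le> \<gamma>" "\<alpha> + \<beta> + \<gamma> \<le> 1"
  shows "\<exists>a' b' c' \<alpha>' \<beta>' \<gamma>'. basis3 a' b' c' \<and> p + a' \<in> K \<and> p + b' \<in> K \<and> p + c' \<in> K \<and>
     0 \<le> \<alpha>' \<and> 0 \<le> \<beta>' \<and> 0 \<le> \<gamma>' \<and> \<alpha>' + \<beta>' + \<gamma>' \<le> 1 \<and>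
     p + \<alpha>' *\<^sub>R a' + \<beta>' *\<^sub>R b' + \<gamma>' *\<^sub>R c' = p + \<alpha> *\<^sub>R a + \<beta> *\<^sub>R b + \<gamma> *\<^sub>R c"
proof -
  obtain a' b' c' \<alpha>' \<beta>' \<gamma>' where s: "subtriangle f a b c a' b' c'" "basis3 a' b' c'"
    and nn': "0 \<le> \<alpha>'" "0 \<le> \<beta>'" "0 \<le> \<gamma>'"
    and eq: "\<alpha>' *\<^sub>R a' + \<beta>' *\<^sub>R b' + \<gamma>' *\<^sub>R c' = \<alpha> *\<^sub>R a + \<beta> *\<^sub>R b + \<gamma> *\<^sub>R c"
    using triangle_refine[OF L(2-4) f D nn(1-3)] by blast
  have "{x. p + x \<in> K} = (+) (- p) ` K" by (force simp: image_iff intro: bexI[of _ "p + _"])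
  then have "convex {x. p + x \<in> K}" using K(1) by (simp only: convex_translation)
  then have "convex hull {a,b,c} \<subseteq> {x. p + x \<in> K}" using K by (intro hull_minimal) auto
  then have K': "p + a' \<in> K" "p + b' \<in> K" "p + c' \<in> K"
    and f': "f a' = 1" "f b' = 1" "f c' = 1"
    using s(1) unfolding subtriangle_def by auto
  have "\<alpha>' + \<beta>' + \<gamma>' = \<alpha> + \<beta> + \<gamma>"
    using arg_cong[OF eq, of f] unfolding integral_form_combination[OF f(1)] f f' by simp
  moreover have "p + \<alpha>' *\<^sub>R a' + \<beta>' *\<^sub>R b' + \<gamma>' *\<^sub>R c' = p + \<alpha> *\<^sub>R a + \<beta> *\<^sub>R b + \<gamma> *\<^sub>R c"
    using eq by (simp add: add.assoc)
  ultimately show ?thesis using s(2) K' nn' nn(4) by metis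
qed

lemma covered_cone:
  assumes f: "integral_form f" "f a = 1" "f b = 1" "f c = 1"
    and L: "p \<in> int_lattice" "a \<in> int_lattice" "b \<in> int_lattice" "c \<in> int_lattice"
    and D: "det3 a b c \<noteq> 0"
    and K: "convex K" "p \<in> K" "p + a \<in> K" "p + b \<in> K" "p + c \<in> K"
    and nn: "0 \<le> \<alpha>" "0 \<le> \<beta>" "0 \<le> \<gamma>" "\<alpha> + \<beta> + \<gamma> \<le> 1"
  shows "covered K (p + \<alpha> *\<^sub>R a + \<beta> *\<^sub>R b + \<gamma> *\<^sub>R c)"
  using cone_refine[OF assms] covered_basis3[OF _ L(1) K(1,2)] by metis

section \<open>Pyramids over unit cells\<close>

text \<open>The pyramid with apex \<open>p\<close> over the parallelogram with corner \<open>r\<close> and sides \<open>u, v\<close> in the next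
  lattice plane. A diagonal cuts the cell into two lattice triangles.\<close>

lemma covered_cell:
  assumes F: "edge_frame f u v e"
    and L: "p \<in> int_lattice" "r \<in> int_lattice" and h: "f r = f p + 1"
    and K: "convex K" "p \<in> K" "r \<in> K" "r + u \<in> K" "r + v \<in> K" "r + u + v \<in> K"
    and t: "0 \<le> t" "t \<le> 1" and b: "0 \<le> \<beta>" "\<beta> \<le> 1" and g: "0 \<le> \<gamma>" "\<gamma> \<le> 1"
  shows "covered K ((1 - t) *\<^sub>R p + t *\<^sub>R (r + \<beta> *\<^sub>R u + \<gamma> *\<^sub>R v))"
proof -
  have I: "integral_form f" and fr: "f u = 0" "f v = 0" "f e = 1" "det3 u v e \<noteq> 0"
    "u \<in> int_lattice" "v \<in> int_lattice"
    using F unfolding edge_frame_def by auto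
  define d where "d = r - p"
  have r: "r = p + d" unfolding d_def by simp
  have dL: "d \<in> int_lattice" unfolding d_def using L by (intro int_lattice_intros)
  have fd: "f d = 1" unfolding d_def integral_form_combination[OF I] h by simp
  have D: "det3 d u v \<noteq> 0" unfolding frame_det[OF F] fd using fr by simp
  note fs = integral_form_combination[OF I]
  show ?thesis
  proof (cases "\<beta> + \<gamma> \<le> 1")
    case True
    have "t * (1 - \<beta> - \<gamma>) + t * \<beta> + t * \<gamma> = t" by (simp add: algebra_simps)
    moreover have "det3 d (d + u) (d + v) = det3 d u v" by (simp add: det_3 vector_3 algebra_simps)
    ultimately have "covered K (p + (t * (1 - \<beta> - \<gamma>)) *\<^sub>R d + (t * \<beta>) *\<^sub>R (d + u) + (t * \<gamma>) *\<^sub>R (d + v))"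
      using K L dL fr fd D t b g True unfolding r
      by (intro covered_cone[OF I]) (simp_all add: fs int_lattice_intros add.assoc)
    moreover have "p + (t * (1 - \<beta> - \<gamma>)) *\<^sub>R d + (t * \<beta>) *\<^sub>R (d + u) + (t * \<gamma>) *\<^sub>R (d + v) =
       (1 - t) *\<^sub>R p + t *\<^sub>R (r + \<beta> *\<^sub>R u + \<gamma> *\<^sub>R v)"
      unfolding r by (simp add: algebra_simps)
    ultimately show ?thesis by simp
  next
    case False
    have "t * (\<beta> + \<gamma> - 1) + t * (1 - \<gamma>) + t * (1 - \<beta>) = t" by (simp add: algebra_simps)
    moreover have "det3 (d + u + v) (d + u) (d + v) = - det3 d u v"
      by (simp add: det_3 vector_3 algebra_simps)
    ultimately have "covered K (p + (t * (\<beta> + \<gamma> - 1)) *\<^sub>R (d + u + v) + (t * (1 - \<gamma>)) *\<^sub>R (d + u)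
        + (t * (1 - \<beta>)) *\<^sub>R (d + v))"
      using K L dL fr fd D t b g False unfolding r
      by (intro covered_cone[OF I]) (simp_all add: fs int_lattice_intros add.assoc)
    moreover have "p + (t * (\<beta> + \<gamma> - 1)) *\<^sub>R (d + u + v) + (t * (1 - \<gamma>)) *\<^sub>R (d + u)
        + (t * (1 - \<beta>)) *\<^sub>R (d + v) = (1 - t) *\<^sub>R p + t *\<^sub>R (r + \<beta> *\<^sub>R u + \<gamma> *\<^sub>R v)"
      unfolding r by (simp add: algebra_simps)
    ultimately show ?thesis by simp
  qed
qed

lemma unit_cell:
  fixes s :: real and N :: int
  assumes "0 \<le> s" "s \<le> of_int N" "1 \<le> N"
  obtains n :: int where "0 \<le> n" "n \<le> N - 1" "of_int n \<le> s" "s \<le> of_int n + 1"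
proof (cases "s = of_int N")
  case True
  then show thesis using assms that[of "N - 1"] by simp
next
  case False
  then have "\<lfloor>s\<rfloor> < N" using assms by (simp add: floor_less_iff)
  then show thesis using assms that[of "\<lfloor>s\<rfloor>"] by simp
qed

text \<open>The lower and the upper face of the layer between heights \<open>i\<close> and \<open>i + 1\<close> are parallelograms. A
  convex combination of a lattice point \<open>(m, n)\<close> of the lower one and any point \<open>(x, y)\<close> of the upper one
  is covered, if the upper one is nondegenerate.\<close>

lemma level_cover:
  assumes F: "edge_frame f u v e" and c: "c \<in> int_lattice"
    and K: "convex K" "edge_simplex c u v e k \<subseteq> K"
    and i: "0 \<le> i" "i \<le> k - 2" and m: "0 \<le> m" "m \<le> k - i" and n: "0 \<le> n" "n \<le> i"
    and s: "0 \<le> x" "x \<le> of_int (k - i - 1)" "0 \<le> y" "y \<le> of_int (i + 1)"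
    and t: "0 \<le> t" "t \<le> 1"
  shows "covered K (c + ((1 - t) * of_int m + t * x) *\<^sub>R u + ((1 - t) * of_int n + t * y) *\<^sub>R v
    + (of_int i + t) *\<^sub>R e)"
proof -
  have I: "integral_form f" and fr: "f u = 0" "f v = 0" "f e = 1"
    and L: "u \<in> int_lattice" "v \<in> int_lattice" "e \<in> int_lattice"
    using F unfolding edge_frame_def by auto
  obtain x0 where x0: "0 \<le> x0" "x0 \<le> k - i - 1 - 1" "of_int x0 \<le> x" "x \<le> of_int x0 + 1"
    using unit_cell[of x "k - i - 1"] s i by auto
  obtain y0 where y0: "0 \<le> y0" "y0 \<le> i + 1 - 1" "of_int y0 \<le> y" "y \<le> of_int y0 + 1"
    using unit_cell[of y "i + 1"] s i by auto
  define q where "q x y h = c + of_int x *\<^sub>R u + of_int y *\<^sub>R v + of_int h *\<^sub>R e" for x y h :: int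
  have qL: "q x y h \<in> int_lattice" for x y h
    unfolding q_def using c L by (intro int_lattice_intros)
  have qK: "q x y h \<in> K" if "0 \<le> h" "h \<le> k" "0 \<le> x" "x \<le> k - h" "0 \<le> y" "y \<le> h" for x y h
  proof -
    have "q x y h \<in> edge_simplex c u v e k" unfolding q_def using that
      by (intro edge_simplexI) (simp_all flip: of_int_diff)
    then show ?thesis using K by blast
  qed
  have fq: "f (q x y h) = f c + of_int h" for x y h
    unfolding q_def integral_form_combination[OF I] fr by simp
  have sh: "q x0 y0 (i+1) + u = q (x0+1) y0 (i+1)" "q x0 y0 (i+1) + v = q x0 (y0+1) (i+1)"
    "q x0 y0 (i+1) + u + v = q (x0+1) (y0+1) (i+1)"
    unfolding q_def by (simp_all add: algebra_simps)
  have "covered K ((1 - t) *\<^sub>R q m n i + t *\<^sub>R (q x0 y0 (i+1) + (x - x0) *\<^sub>R u + (y - y0) *\<^sub>R v))"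
  proof (rule covered_cell[OF F qL qL])
    show "q x0 y0 (i+1) + u \<in> K" unfolding sh(1) using x0 y0 i by (auto intro!: qK)
    show "q x0 y0 (i+1) + v \<in> K" unfolding sh(2) using x0 y0 i by (auto intro!: qK)
    show "q x0 y0 (i+1) + u + v \<in> K" unfolding sh(3) using x0 y0 i by (auto intro!: qK)
  qed (use K t x0 y0 i m n in \<open>auto intro!: qK simp: fq\<close>)
  also have "(1 - t) *\<^sub>R q m n i + t *\<^sub>R (q x0 y0 (i+1) + (x - x0) *\<^sub>R u + (y - y0) *\<^sub>R v) =
    c + ((1 - t) * of_int m + t * x) *\<^sub>R u + ((1 - t) * of_int n + t * y) *\<^sub>R v + (of_int i + t) *\<^sub>R e"
    unfolding q_def by (simp add: algebra_simps)
  finally show ?thesis .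
qed

text \<open>Copies of the interval \<open>[0, t n]\<close>, with \<open>n \<ge> 1\<close>, placed in steps of \<open>1 - t \<le> t\<close>, leave no
  gap.\<close>

lemma integer_step:
  fixes t x :: real and N :: int
  assumes t: "1/2 \<le> t" "t \<le> 1" and n: "1 \<le> n" and N: "0 \<le> N"
    and x: "0 \<le> x" "x \<le> (1 - t) * of_int N + t * of_int n"
  obtains m :: int and s :: real where "0 \<le> m" "m \<le> N" "0 \<le> s" "s \<le> of_int n"
    "x = (1 - t) * of_int m + t * s"
proof (cases "(1 - t) * of_int N \<le> x")
  case True
  then show thesis using that[of N "(x - (1 - t) * of_int N) / t"] assms
    by (simp add: field_simps)
next
  case False
  then have pos: "0 < 1 - t" using t x by (cases "t = 1") auto
  define m where "m = \<lfloor>x / (1 - t)\<rfloor>"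
  have "x / (1 - t) < of_int N" using False pos by (simp add: field_simps)
  then have m: "0 \<le> m" "m \<le> N" unfolding m_def using x pos by (auto simp: floor_le_iff)
  have "of_int m \<le> x / (1 - t)" "x / (1 - t) < of_int m + 1" unfolding m_def by linarith+
  then have b: "(1 - t) * of_int m \<le> x" "x < (1 - t) * of_int m + (1 - t)"
    using pos by (simp_all add: field_simps)
  have "t * 1 \<le> t * of_int n" using t n by (intro mult_left_mono) auto
  then have "x - (1 - t) * of_int m \<le> t * of_int n" using b t by linarith
  then have "(x - (1 - t) * of_int m) / t \<le> of_int n"
    using t by (simp add: pos_divide_le_eq mult.commute)
  moreover have "0 \<le> (x - (1 - t) * of_int m) / t" using b t by simp
  ultimately show thesis using that[OF m, of "(x - (1 - t) * of_int m) / t"] t by simp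
qed

lemma upper_half_cover:
  assumes F: "edge_frame f u v e" and c: "c \<in> int_lattice"
    and K: "convex K" "edge_simplex c u v e k \<subseteq> K"
    and i: "0 \<le> i" "i \<le> k - 2" and t: "1/2 \<le> t" "t \<le> 1"
    and x: "0 \<le> x" "x \<le> of_int k - (of_int i + t)" and y: "0 \<le> y" "y \<le> of_int i + t"
  shows "covered K (c + x *\<^sub>R u + y *\<^sub>R v + (of_int i + t) *\<^sub>R e)"
proof -
  have "x \<le> (1 - t) * of_int (k - i) + t * of_int (k - i - 1)"
    using x by (simp add: algebra_simps)
  then obtain m x' where m: "0 \<le> m" "m \<le> k - i" "0 \<le> x'" "x' \<le> of_int (k - i - 1)"
    "x = (1 - t) * of_int m + t * x'"
    using integer_step[of t "k - i - 1" "k - i" x] t x i by auto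
  have "y \<le> (1 - t) * of_int i + t * of_int (i + 1)"
    using y by (simp add: algebra_simps)
  then obtain n y' where n: "0 \<le> n" "n \<le> i" "0 \<le> y'" "y' \<le> of_int (i + 1)"
    "y = (1 - t) * of_int n + t * y'"
    using integer_step[of t "i + 1" i y] t y i by auto
  show ?thesis unfolding m(5) n(5) using level_cover[OF F c K i m(1,2) n(1,2) m(3,4) n(3,4)] t by auto
qed

section \<open>The bottom layer\<close>

text \<open>A primitive vector \<open>u\<close> extends to a lattice basis \<open>u, w, e\<close> with \<open>f w = 0\<close>: take \<open>w\<close> with the
  smallest nonzero determinant, on the same side of \<open>u\<close> as \<open>v\<close>.\<close>

lemma primitive_basis:
  assumes F: "edge_frame f u v e" and pu: "lattice_primitive u"
  obtains w and p q :: int where "basis3 u w e" "v = of_int p *\<^sub>R u + of_int q *\<^sub>R w" "0 < q"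
proof -
  have I: "integral_form f" and fr: "f u = 0" "f v = 0" "f e = 1" and D: "det3 u v e \<noteq> 0"
    and L: "u \<in> int_lattice" "v \<in> int_lattice" "e \<in> int_lattice"
    using F unfolding edge_frame_def by auto
  let ?P = "\<lambda>w. w \<in> int_lattice \<and> f w = 0 \<and> 0 < det3 u w e * det3 u v e"
  let ?m = "\<lambda>w. nat \<lfloor>\<bar>det3 u w e\<bar>\<rfloor>"
  have "0 < det3 u v e * det3 u v e" using D by (metis not_real_square_gt_zero)
  then have "?P v" using L fr by simp
  then obtain w where w: "?P w" and min: "\<And>w'. ?P w' \<Longrightarrow> ?m w \<le> ?m w'"
    using ex_has_least_nat[of ?P v ?m] by blast
  have Dw: "det3 u w e \<noteq> 0" using w by auto
  have B: "\<exists>l m n :: int. z = of_int l *\<^sub>R u + of_int m *\<^sub>R w + of_int n *\<^sub>R e"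
    if z: "z \<in> int_lattice" for z
  proof -
    obtain x y h where xyz: "z = x *\<^sub>R u + y *\<^sub>R w + h *\<^sub>R e" using det3_coordinates[OF Dw] .
    have "f z = h" unfolding xyz integral_form_combination[OF I] using w fr by simp
    then have "h \<in> \<int>" using z I unfolding integral_form_def by blast
    then obtain n :: int where n: "h = of_int n" by (metis Ints_cases)
    define z' where "z' = frac x *\<^sub>R u + frac y *\<^sub>R w + 0 *\<^sub>R e"
    have "z' = z - (of_int \<lfloor>x\<rfloor> *\<^sub>R u + of_int \<lfloor>y\<rfloor> *\<^sub>R w + of_int n *\<^sub>R e)"
      unfolding z'_def xyz n by (simp add: frac_def algebra_simps)
    then have z'L: "z' \<in> int_lattice" using z L w by (auto intro!: int_lattice_intros)
    have dz: "det3 u z' e = frac y * det3 u w e" unfolding z'_def det3_combination ..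
    have fz: "f z' = 0" unfolding z'_def integral_form_combination[OF I] using w fr by simp
    have fy: "frac y = 0"
    proof (rule ccontr)
      assume "frac y \<noteq> 0"
      then have y: "0 < frac y" "frac y < 1" using frac_ge_0[of y] frac_lt_1[of y] by linarith+
      then have "?P z'" using z'L fz w unfolding dz by (simp add: mult.assoc del: frac_gt_0_iff)
      then have "?m w \<le> ?m z'" by (rule min)
      moreover have "\<bar>det3 u z' e\<bar> < \<bar>det3 u w e\<bar>" unfolding dz abs_mult using y Dw by simp
      then have "?m z' < ?m w" using L w z'L by (intro det3_descent) auto
      ultimately show False by simp
    qed
    have fx: "frac x = 0"
    proof (rule ccontr)
      assume "frac x \<noteq> 0"
      then have "0 < frac x" "frac x < 1" using frac_ge_0[of x] frac_lt_1[of x] by linarith+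
      then show False using pu z'L unfolding lattice_primitive_def z'_def fy by auto
    qed
    have "x = of_int \<lfloor>x\<rfloor>" "y = of_int \<lfloor>y\<rfloor>" using fx fy by (auto simp: frac_def)
    then show ?thesis using xyz n by metis
  qed
  then have bas: "basis3 u w e" using L w Dw unfolding basis3_def by blast
  obtain p q n :: int where v: "v = of_int p *\<^sub>R u + of_int q *\<^sub>R w + of_int n *\<^sub>R e"
    using B[OF L(2)] by blast
  have "f v = of_int n" unfolding v integral_form_combination[OF I] using w fr by simp
  then have n: "n = 0" using fr by simp
  have "det3 u v e = of_int q * det3 u w e" unfolding v det3_combination ..
  then have "0 < of_int q * (det3 u w e * det3 u w e)" using w by (simp add: algebra_simps)
  then have "0 < q" by (simp add: zero_less_mult_iff)
  then show thesis using that[OF bas, of p q] v n by simp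
qed

text \<open>The edges at a vertex of the tetrahedron spanned by a unit step along \<open>u\<close> and two lattice points
  in the rows \<open>j\<close> and \<open>j + 1\<close> of the next lattice plane.\<close>

lemma basis3_shear:
  assumes "basis3 u w e"
  shows "basis3 u (e + of_int a *\<^sub>R u + of_int j *\<^sub>R w) (e + of_int b *\<^sub>R u + of_int (j + 1) *\<^sub>R w)"
    (is "basis3 u ?a ?b")
proof -
  have "det3 u ?a ?b = - det3 u w e" by (simp add: det_3 vector_3 algebra_simps)
  moreover
  have "\<exists>l' m' n' :: int. of_int l *\<^sub>R u + of_int m *\<^sub>R w + of_int n *\<^sub>R e =
      of_int l' *\<^sub>R u + of_int m' *\<^sub>R ?a + of_int n' *\<^sub>R ?b" for l m n :: int
    by (intro exI[of _ "l - a * (n - (m - j * n)) - b * (m - j * n)"] exI[of _ "n - (m - j * n)"]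
      exI[of _ "m - j * n"]) (simp add: algebra_simps)
  then have "\<exists>l m n :: int. z = of_int l *\<^sub>R u + of_int m *\<^sub>R ?a + of_int n *\<^sub>R ?b"
    if "z \<in> int_lattice" for z
    using assms that unfolding basis3_def by (elim conjE ballE exE) auto
  moreover have "u \<in> int_lattice" "?a \<in> int_lattice" "?b \<in> int_lattice"
    using assms unfolding basis3_def by (auto simp del: of_int_add intro!: int_lattice_intros)
  ultimately show ?thesis using assms unfolding basis3_def by simp
qed

lemma scaled_interval:
  fixes t x a :: real
  assumes "0 \<le> t" "0 \<le> x" "x \<le> t * a" "0 \<le> a"
  obtains s where "0 \<le> s" "s \<le> a" "x = t * s"
proof (cases "t = 0")
  case True
  then show thesis using assms that[of 0] by auto
next
  case False
  then show thesis using assms that[of "x / t"] by (auto simp: field_simps)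
qed

text \<open>Points of height \<open>t \<le> 1\<close>. Those near the left or the right face lie in pyramids. For the others, the offset \<open>\<delta>\<close> along \<open>u\<close> from the lattice path, scaled by \<open>t\<close>, lies
  between \<open>0\<close> and \<open>(1 - t) k\<close> and selects a unit step of the bottom segment.\<close>

lemma bottom_cover:
  assumes F: "edge_frame f u v e" and pu: "lattice_primitive u" and c: "c \<in> int_lattice"
    and K: "convex K" "edge_simplex c u v e k \<subseteq> K" and k: "2 \<le> k"
    and t: "0 \<le> t" "t \<le> 1"
    and x: "0 \<le> x" "x \<le> of_int k - t" and y: "0 \<le> y" "y \<le> t"
  shows "covered K (c + x *\<^sub>R u + y *\<^sub>R v + t *\<^sub>R e)"
proof -
  have k2: "2 \<le> (of_int k :: real)" using k by simp
  obtain y' where y': "0 \<le> y'" "y' \<le> 1" "y = t * y'"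
    using scaled_interval[of t y 1] y t by auto
  \<comment> \<open>In the first two cases the apex is the left or the right end of the bottom segment. In the third,
    \<open>x\<close> keeps the margin \<open>t\<close> needed because the path lies between \<open>0\<close> and \<open>t\<close> to the right of the
    left side.\<close>
  consider "x \<le> t" | "(1 - t) * of_int k \<le> x" | "t < x" "x < (1 - t) * of_int k" by linarith
  then show ?thesis
  proof cases
    case 1
    obtain x' where x': "0 \<le> x'" "x' \<le> 1" "x = t * x'"
      using scaled_interval[of t x 1] x t 1 by auto
    show ?thesis
      using level_cover[OF F c K, of 0 0 0 x' y' t] k k2 x' y' t by simp
  next
    case 2
    obtain x' where x': "0 \<le> x'" "x' \<le> of_int k - 1" "x - (1 - t) * of_int k = t * x'"
      using scaled_interval[of t "x - (1 - t) * of_int k" "of_int k - 1"] x t k2 2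
      by (auto simp: algebra_simps)
    have "x = (1 - t) * of_int k + t * x'" using x'(3) by simp
    then show ?thesis
      unfolding y'(3) using level_cover[OF F c K, of 0 k 0 x' y' t] k x'(1,2) y' t by simp
  next
    case 3
    obtain w and p q :: int where bas: "basis3 u w e"
      and v: "v = of_int p *\<^sub>R u + of_int q *\<^sub>R w" and q: "0 < q"
      using primitive_basis[OF F pu] .
    define \<eta> where "\<eta> = of_int q * y'"
    have \<eta>: "0 \<le> \<eta>" "\<eta> \<le> of_int q" "of_int q * y' = \<eta>"
      unfolding \<eta>_def using y' q by (auto simp: mult_left_le)
    obtain j where j: "0 \<le> j" "j \<le> q - 1" "of_int j \<le> \<eta>" "\<eta> \<le> of_int j + 1"
      using unit_cell[of \<eta> q] \<eta> q by auto
    define l where "l = \<eta> - of_int j"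
    have l: "0 \<le> l" "l \<le> 1" unfolding l_def using j by auto
    \<comment> \<open>The edge \<open>v\<close> meets row \<open>j\<close> at \<open>p j / q\<close>, so \<open>g j\<close> is the first lattice point of the
      parallelogram in this row.\<close>
    define g where "g j = \<lceil>of_int p * of_int j / of_int q :: real\<rceil>" for j
    have gb: "of_int p * of_int j / of_int q \<le> (of_int (g j) :: real)"
      "of_int (g j) \<le> of_int p * of_int j / of_int q + (1::real)" for j
      unfolding g_def by linarith+
    \<comment> \<open>\<open>\<xi>\<close> is the coordinate along \<open>u\<close> of the point of the path with coordinate \<open>\<eta> = j + l\<close> along \<open>w\<close>.\<close>
    define \<xi> where "\<xi> = (1 - l) * of_int (g j) + l * of_int (g (j + 1))"
    have py: "of_int p * y' = (1 - l) * (of_int p * of_int j / of_int q)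
        + l * (of_int p * of_int (j + 1) / of_int q)"
    proof -
      have y'_eq: "y' = (of_int j + l) / of_int q"
        using \<eta>(3) q unfolding l_def by (simp add: field_simps)
      show ?thesis unfolding y'_eq using q by (simp add: field_simps)
    qed
    have \<xi>1: "of_int p * y' \<le> \<xi>" unfolding \<xi>_def py
      using l gb by (intro add_mono mult_left_mono) (auto simp del: of_int_add)
    have "\<xi> \<le> (1 - l) * (of_int p * of_int j / of_int q + 1)
        + l * (of_int p * of_int (j + 1) / of_int q + 1)" unfolding \<xi>_def
      using l gb by (intro add_mono mult_left_mono) (auto simp del: of_int_add)
    also have "\<dots> = of_int p * y' + 1" unfolding py by (simp add: algebra_simps)
    finally have \<xi>2: "\<xi> \<le> of_int p * y' + 1" .
    define \<delta> where "\<delta> = x + t * (of_int p * y') - t * \<xi>"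
    have "t * (of_int p * y') \<le> t * \<xi>" "t * \<xi> \<le> t * (of_int p * y' + 1)"
      using \<xi>1 \<xi>2 t by (auto intro: mult_left_mono)
    then have \<delta>: "0 \<le> \<delta>" "\<delta> \<le> (1 - t) * of_int k" using 3 unfolding \<delta>_def
      by (auto simp: algebra_simps)
    obtain s where s: "0 \<le> s" "s \<le> of_int k" "\<delta> = (1 - t) * s"
      using scaled_interval[of "1 - t" \<delta> "of_int k"] \<delta> t k2 by auto
    obtain m where m: "0 \<le> m" "m \<le> k - 1" "of_int m \<le> s" "s \<le> of_int m + 1"
      using unit_cell[of s k] s k by auto
    let ?p = "c + of_int m *\<^sub>R u"
    let ?d = "\<lambda>j. e + of_int (g j - m) *\<^sub>R u + of_int j *\<^sub>R w"
    have bot: "c + of_int n *\<^sub>R u \<in> K" if "0 \<le> n" "n \<le> k" for n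
      using edge_simplexI[of 0 k "of_int n" 0 c u v e] that K(2) k by auto
    have top: "?p + ?d j \<in> K" if "0 \<le> j" "j \<le> q" for j
    proof -
      let ?h = "of_int j / of_int q :: real"
      have w: "of_int j *\<^sub>R w = ?h *\<^sub>R v - (of_int p * ?h) *\<^sub>R u"
        unfolding v using q by (simp add: algebra_simps)
      have "?p + ?d j = c + (of_int (g j) - of_int p * ?h) *\<^sub>R u + ?h *\<^sub>R v + 1 *\<^sub>R e"
        unfolding w by (simp add: algebra_simps)
      also have "\<dots> \<in> edge_simplex c u v e k"
        using that q k2 gb[of j] by (intro edge_simplexI) auto
      finally show ?thesis using K(2) by blast
    qed
    have "covered K (?p + ((1 - t) * (s - of_int m)) *\<^sub>R u + (t * (1 - l)) *\<^sub>R ?d j + (t * l) *\<^sub>R ?d (j + 1))"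
    proof (rule covered_basis3[OF basis3_shear[OF bas]])
      show "?p \<in> int_lattice" using c F unfolding edge_frame_def by (intro int_lattice_intros) auto
      show "?p \<in> K" using bot m by auto
      have pu: "?p + u = c + of_int (m + 1) *\<^sub>R u" by (simp add: algebra_simps)
      show "?p + u \<in> K" unfolding pu using m by (intro bot) auto
      show "?p + ?d j \<in> K" "?p + ?d (j + 1) \<in> K" using j by (intro top; simp)+
      have "(1 - t) * (s - of_int m) \<le> (1 - t) * 1" using m t by (intro mult_left_mono) auto
      then show "(1 - t) * (s - of_int m) + t * (1 - l) + t * l \<le> 1" by (simp add: algebra_simps)
    qed (use K m t l in auto)
    also have "?p + ((1 - t) * (s - of_int m)) *\<^sub>R u + (t * (1 - l)) *\<^sub>R ?d j + (t * l) *\<^sub>R ?d (j + 1)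
      = c + ((1 - t) * s + t * \<xi>) *\<^sub>R u + (t * (of_int j + l)) *\<^sub>R w + t *\<^sub>R e"
      unfolding \<xi>_def by (simp add: algebra_simps)
    also have "(1 - t) * s + t * \<xi> = x + of_int p * y" using s(3) unfolding \<delta>_def y'(3) by (simp add: algebra_simps)
    also have "t * (of_int j + l) = of_int q * y" unfolding l_def y'(3) using \<eta>(3) by simp
    also have "c + (x + of_int p * y) *\<^sub>R u + (of_int q * y) *\<^sub>R w + t *\<^sub>R e = c + x *\<^sub>R u + y *\<^sub>R v + t *\<^sub>R e"
      unfolding v by (simp add: algebra_simps)
    finally show ?thesis .
  qed
qed

section \<open>Covering the dilated tetrahedron\<close>

lemma edge_simplex_cover:
  assumes F: "edge_frame f u v e" and pu: "lattice_primitive u" and pv: "lattice_primitive v"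
    and c: "c \<in> int_lattice"
    and K: "convex K" "edge_simplex c u v e k \<subseteq> K" and k: "2 \<le> k"
    and z: "z \<in> edge_simplex c u v e k"
  shows "covered K z"
proof -
  obtain x y h where z: "z = c + x *\<^sub>R u + y *\<^sub>R v + h *\<^sub>R e"
      and b: "0 \<le> h" "h \<le> of_int k" "0 \<le> x" "x \<le> of_int k - h" "0 \<le> y" "y \<le> h"
      using z unfolding edge_simplex_def by blast
  let ?c = "c + of_int k *\<^sub>R e"
  have c': "?c \<in> int_lattice" using c F unfolding edge_frame_def by (intro int_lattice_intros) auto
  note F' = edge_frame_swap[OF F]
  have K': "edge_simplex ?c v u (- e) k \<subseteq> K" using K(2) by (simp add: edge_simplex_swap)
  have z': "z = ?c + y *\<^sub>R v + x *\<^sub>R u + (of_int k - h) *\<^sub>R (- e)"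
    unfolding z by (simp add: algebra_simps)
  obtain i where i: "0 \<le> i" "i \<le> k - 1" "of_int i \<le> h" "h \<le> of_int i + 1"
    using unit_cell[of h k] b k by auto
  \<comment> \<open>The second and the fourth case are the first and the third one seen from the other edge.\<close>
  consider "1/2 \<le> h - of_int i" "i \<le> k - 2" | "h - of_int i \<le> 1/2" "1 \<le> i"
    | "i = 0" | "i = k - 1" using i k by linarith
  then show ?thesis
  proof cases
    case 1
    show ?thesis unfolding z
      using upper_half_cover[OF F c K i(1) 1(2,1)] b i by auto
  next
    case 2
    have eq: "of_int (k - i - 1) + (1 - (h - of_int i)) = of_int k - h" by simp
    show ?thesis unfolding z'
      using upper_half_cover[OF F' c' K(1) K', of "k - i - 1" "1 - (h - of_int i)" y x] b i 2
      unfolding eq by auto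
  next
    case 3
    then show ?thesis unfolding z using bottom_cover[OF F pu c K k] b i by auto
  next
    case 4
    then show ?thesis unfolding z' using bottom_cover[OF F' pv c' K(1) K' k, of "of_int k - h" y x] b i by auto
  qed
qed

section \<open>Decomposing a polytope of width one\<close>

text \<open>The point \<open>y\<close> lies in a lattice tetrahedron with vertices \<open>a, a + u, a + e, a + e + v\<close> in \<open>P\<close>.\<close>

definition edge_cell where
  "edge_cell P y f a u v e \<longleftrightarrow> edge_frame f u v e \<and> a \<in> int_lattice \<and>
     {a, a + u, a + e, a + e + v} \<subseteq> P \<and> y \<in> edge_simplex a u v e 1"

lemma edge_cell_swap:
  assumes "edge_cell P y f a u v e"
  shows "edge_cell P y (\<lambda>x. - f x) (a + e) v u (- e)"
  using assms edge_frame_swap[of f u v e] edge_simplex_swap[of a 1 e v u]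
  unfolding edge_cell_def by (auto simp: edge_frame_def intro: int_lattice_add)

text \<open>A lattice point in the interior of the edge \<open>[a, a + u]\<close> divides the tetrahedron into two
  smaller ones of the same kind.\<close>

lemma edge_cell_shrink:
  assumes c: "edge_cell P y f a u v e" and s: "0 < s" "s < 1" "s *\<^sub>R u \<in> int_lattice"
    and P: "convex P"
  shows "\<exists>a' u' e'. edge_cell P y f a' u' v e' \<and> \<bar>det3 u' v e'\<bar> < \<bar>det3 u v e\<bar>"
proof -
  have F: "edge_frame f u v e" and a: "a \<in> int_lattice"
    and aP: "a \<in> P" "a + u \<in> P" "a + e \<in> P" "a + e + v \<in> P"
    and y: "y \<in> edge_simplex a u v e 1" using c unfolding edge_cell_def by auto
  have I: "integral_form f" and fr: "f u = 0" "f v = 0" "f e = 1" and D: "det3 u v e \<noteq> 0"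
    and L: "u \<in> int_lattice" "v \<in> int_lattice" "e \<in> int_lattice"
    using F unfolding edge_frame_def by auto
  note fs = integral_form_combination[OF I]
  have su: "a + s *\<^sub>R u \<in> P"
  proof -
    have "(1 - s) *\<^sub>R a + s *\<^sub>R (a + u) \<in> P" using P aP s by (intro convexD) auto
    then show ?thesis by (simp add: algebra_simps)
  qed
  obtain x z h where yeq: "y = a + x *\<^sub>R u + z *\<^sub>R v + h *\<^sub>R e"
    and b: "0 \<le> h" "h \<le> 1" "0 \<le> x" "x \<le> 1 - h" "0 \<le> z" "z \<le> h"
    using y unfolding edge_simplex_def by auto
  \<comment> \<open>The two parts are separated by the plane through \<open>a + s u\<close> and the opposite edge.\<close>
  show ?thesis
  proof (cases "x \<le> s * (1 - h)")
    case True
    let ?u = "s *\<^sub>R u"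
    have d: "det3 ?u v e = s * det3 u v e" by (simp add: det_3 vector_3 algebra_simps)
    have "edge_frame f ?u v e" unfolding edge_frame_def using I fr L s D d by (simp add: fs)
    moreover have eq: "y = a + (x / s) *\<^sub>R ?u + z *\<^sub>R v + h *\<^sub>R e" unfolding yeq using s by simp
    have "y \<in> edge_simplex a ?u v e 1" unfolding eq
      using True b s by (intro edge_simplexI) (auto simp: pos_divide_le_eq mult.commute)
    ultimately have "edge_cell P y f a ?u v e"
      unfolding edge_cell_def using a aP su by simp
    moreover have "\<bar>det3 ?u v e\<bar> < \<bar>det3 u v e\<bar>" unfolding d abs_mult using s D by simp
    ultimately show ?thesis by blast
  next
    case False
    let ?a = "a + s *\<^sub>R u" and ?u = "(1 - s) *\<^sub>R u" and ?e = "e - s *\<^sub>R u"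
    have d: "det3 ?u v ?e = (1 - s) * det3 u v e" by (simp add: det_3 vector_3 algebra_simps)
    have uL: "?u \<in> int_lattice" using int_lattice_diff[OF L(1) s(3)] by (simp add: algebra_simps)
    have "edge_frame f ?u v ?e" unfolding edge_frame_def
      using I fr L s D d uL by (simp add: fs int_lattice_intros)
    moreover have "((x - s * (1 - h)) / (1 - s)) *\<^sub>R ?u = (x - s * (1 - h)) *\<^sub>R u" using s by simp
    then have eq: "y = ?a + ((x - s * (1 - h)) / (1 - s)) *\<^sub>R ?u + z *\<^sub>R v + h *\<^sub>R ?e"
      unfolding yeq by (simp only:) (simp add: algebra_simps)
    have "x - s * (1 - h) \<le> (1 - h) * (1 - s)" using b by (simp add: algebra_simps)
    then have "(x - s * (1 - h)) / (1 - s) \<le> 1 - h" "0 \<le> (x - s * (1 - h)) / (1 - s)"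
      using False s by (simp_all add: pos_divide_le_eq)
    then have "y \<in> edge_simplex ?a ?u v ?e 1" unfolding eq
      using b by (intro edge_simplexI) auto
    moreover have vs: "?a + ?u = a + u" "?a + ?e = a + e" "?a + ?e + v = a + e + v"
      by (simp_all add: algebra_simps)
    have "{?a, ?a + ?u, ?a + ?e, ?a + ?e + v} \<subseteq> P" unfolding vs using aP su by simp
    ultimately have "edge_cell P y f ?a ?u v ?e"
      unfolding edge_cell_def using a s by (simp only: int_lattice_add)
    moreover have "\<bar>det3 ?u v ?e\<bar> < \<bar>det3 u v e\<bar>" unfolding d abs_mult using s D by simp
    ultimately show ?thesis by blast
  qed
qed

lemma edge_cell_primitive:
  assumes "edge_cell P y f a u v e" and P: "convex P"
  shows "\<exists>f a u v e. edge_cell P y f a u v e \<and> lattice_primitive u \<and> lattice_primitive v"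
  using assms(1)
proof (induction "nat \<lfloor>\<bar>det3 u v e\<bar>\<rfloor>" arbitrary: f a u v e rule: less_induct)
  case less
  have dec: "nat \<lfloor>\<bar>det3 u' v' e'\<bar>\<rfloor> < nat \<lfloor>\<bar>det3 u v e\<bar>\<rfloor>"
    if "edge_cell P y f' a' u' v' e'" "\<bar>det3 u' v' e'\<bar> < \<bar>det3 u v e\<bar>" for f' a' u' v' e'
    using less.prems that unfolding edge_cell_def edge_frame_def by (intro det3_descent) auto
  consider "lattice_primitive u" "lattice_primitive v" | "\<not> lattice_primitive u" | "\<not> lattice_primitive v"
    by blast
  then show ?case
  proof cases
    case 1
    then show ?thesis using less.prems by blast
  next
    case 2
    then obtain s where "0 < s" "s < 1" "s *\<^sub>R u \<in> int_lattice" unfolding lattice_primitive_def by blast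
    from edge_cell_shrink[OF less.prems this P] show ?thesis using less.hyps dec by blast
  next
    case 3
    then obtain s where "0 < s" "s < 1" "s *\<^sub>R v \<in> int_lattice" unfolding lattice_primitive_def by blast
    from edge_cell_shrink[OF edge_cell_swap[OF less.prems] this P]
    obtain a' u' e' where st: "edge_cell P y (\<lambda>x. - f x) a' u' u e'"
      "\<bar>det3 u' u e'\<bar> < \<bar>det3 v u (- e)\<bar>" by blast
    moreover have "det3 v u (- e) = det3 u v e" by (simp add: det_3 vector_3 algebra_simps)
    ultimately show ?thesis using less.hyps dec by metis
  qed
qed

text \<open>A tetrahedron with one vertex in one lattice plane and three in the next refines to unimodular
  tetrahedra. A unimodular tetrahedron \<open>p, p + a', p + b', p + c'\<close> is spanned by its edges
  \<open>[p, p + a']\<close> and \<open>[p + b', p + c']\<close>, which lie in consecutive lattice planes of another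
  functional: the sum of the second and third coordinates.\<close>

lemma edge_cell_of_cone:
  assumes f: "integral_form f" "f a = 1" "f b = 1" "f c = 1"
    and L: "p \<in> int_lattice" "a \<in> int_lattice" "b \<in> int_lattice" "c \<in> int_lattice"
    and D: "det3 a b c \<noteq> 0"
    and K: "convex K" "p \<in> K" "p + a \<in> K" "p + b \<in> K" "p + c \<in> K"
    and nn: "0 \<le> \<alpha>" "0 \<le> \<beta>" "0 \<le> \<gamma>" "\<alpha> + \<beta> + \<gamma> \<le> 1"
  shows "\<exists>f a' u v e. edge_cell K (p + \<alpha> *\<^sub>R a + \<beta> *\<^sub>R b + \<gamma> *\<^sub>R c) f a' u v e"
proof -
  obtain a' b' c' \<alpha>' \<beta>' \<gamma>' where B: "basis3 a' b' c'"
    and K': "p + a' \<in> K" "p + b' \<in> K" "p + c' \<in> K"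
    and nn': "0 \<le> \<alpha>'" "0 \<le> \<beta>'" "0 \<le> \<gamma>'" "\<alpha>' + \<beta>' + \<gamma>' \<le> 1"
    and eq: "p + \<alpha>' *\<^sub>R a' + \<beta>' *\<^sub>R b' + \<gamma>' *\<^sub>R c' = p + \<alpha> *\<^sub>R a + \<beta> *\<^sub>R b + \<gamma> *\<^sub>R c"
    using cone_refine[OF assms] by blast
  have L': "a' \<in> int_lattice" "b' \<in> int_lattice" "c' \<in> int_lattice" and D': "det3 a' b' c' \<noteq> 0"
    using B unfolding basis3_def by auto
  define g where "g z = (det3 a' z c' + det3 a' b' z) / det3 a' b' c'" for z
  have g: "g (x *\<^sub>R a' + y *\<^sub>R b' + z *\<^sub>R c') = y + z" for x y z
    unfolding g_def det3_combination using D' by (simp add: field_simps)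
  have "linear g" unfolding g_def
    by (rule linearI) (simp_all add: det_3 vector_3 divide_simps, simp_all add: algebra_simps)
  moreover have "g z \<in> \<int>" if zL: "z \<in> int_lattice" for z
  proof -
    obtain l m n :: int where z: "z = of_int l *\<^sub>R a' + of_int m *\<^sub>R b' + of_int n *\<^sub>R c'"
      using B zL unfolding basis3_def by blast
    show ?thesis unfolding z g by simp
  qed
  ultimately have I: "integral_form g" unfolding integral_form_def by blast
  have ga: "g a' = 0" "g b' = 1" "g c' = 1" using g[of 1 0 0] g[of 0 1 0] g[of 0 0 1] by auto
  have "det3 a' (c' - b') b' = - det3 a' b' c'" by (simp add: det_3 vector_3 algebra_simps)
  then have "edge_frame g a' (c' - b') b'" unfolding edge_frame_def
    using I L' D' ga by (simp add: int_lattice_diff integral_form_combination[OF I])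
  moreover have eq': "p + \<alpha>' *\<^sub>R a' + \<beta>' *\<^sub>R b' + \<gamma>' *\<^sub>R c' = p + \<alpha>' *\<^sub>R a' + \<gamma>' *\<^sub>R (c' - b') + (\<beta>' + \<gamma>') *\<^sub>R b'"
    by (simp add: algebra_simps)
  have "p + \<alpha>' *\<^sub>R a' + \<beta>' *\<^sub>R b' + \<gamma>' *\<^sub>R c' \<in> edge_simplex p a' (c' - b') b' 1"
    unfolding eq' using nn' by (intro edge_simplexI) auto
  ultimately have "edge_cell K (p + \<alpha>' *\<^sub>R a' + \<beta>' *\<^sub>R b' + \<gamma>' *\<^sub>R c') g p a' (c' - b') b'"
    unfolding edge_cell_def using L K K' by simp
  then show ?thesis unfolding eq by blast
qed

lemma det3_affine_independent:
  assumes "\<not> affine_dependent {p0, p1, p2, p3}" "distinct [p0, p1, p2, p3]"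
  shows "det3 (p1 - p0) (p2 - p0) (p3 - p0) \<noteq> 0"
proof -
  let ?A = "vector [p1 - p0, p2 - p0, p3 - p0] :: real^3^3"
  have "c 1 = 0 \<and> c 2 = 0 \<and> c 3 = 0"
    if "c 1 *\<^sub>R (p1 - p0) + c 2 *\<^sub>R (p2 - p0) + c 3 *\<^sub>R (p3 - p0) = 0" for c :: "3 \<Rightarrow> real"
  proof -
    define U where "U v = (if v = p1 then c 1 else if v = p2 then c 2 else if v = p3 then c 3
      else - (c 1 + c 2 + c 3))" for v
    have U: "U p0 = - (c 1 + c 2 + c 3)" "U p1 = c 1" "U p2 = c 2" "U p3 = c 3"
      using assms(2) unfolding U_def by auto
    have "sum U {p0,p1,p2,p3} = 0" using assms(2) U by simp
    moreover have "(\<Sum>v\<in>{p0,p1,p2,p3}. U v *\<^sub>R v) = 0"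
    proof -
      have "(\<Sum>v\<in>{p0,p1,p2,p3}. U v *\<^sub>R v) =
          U p0 *\<^sub>R p0 + U p1 *\<^sub>R p1 + U p2 *\<^sub>R p2 + U p3 *\<^sub>R p3"
        using assms(2) by (simp add: add.assoc)
      also have "\<dots> = c 1 *\<^sub>R (p1 - p0) + c 2 *\<^sub>R (p2 - p0) + c 3 *\<^sub>R (p3 - p0)"
        unfolding U by (simp add: algebra_simps)
      finally show ?thesis using that by simp
    qed
    ultimately have "\<forall>v\<in>{p0,p1,p2,p3}. U v = 0"
      using assms(1) affine_dependent_explicit_finite[of "{p0,p1,p2,p3}"] by blast
    then show ?thesis using U by auto
  qed
  then have "\<forall>c. (\<Sum>i\<in>UNIV. c i *s row i ?A) = 0 \<longrightarrow> (\<forall>i. c i = 0)"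
    by (simp add: sum_3 forall_3 row_def scalar_mult_eq_scaleR)
  then have "\<exists>B. ?A ** B = mat 1" by (simp only: matrix_right_invertible_independent_rows)
  then show ?thesis using invertible_right_inverse invertible_det_nz by blast
qed

lemma simplex_coordinates:
  assumes "y \<in> convex hull {p0, p1, p2, p3}" "distinct [p0, p1, p2, p3]"
  obtains x1 x2 x3 where "0 \<le> x1" "0 \<le> x2" "0 \<le> x3" "x1 + x2 + x3 \<le> 1"
    "y = p0 + x1 *\<^sub>R (p1 - p0) + x2 *\<^sub>R (p2 - p0) + x3 *\<^sub>R (p3 - p0)"
proof -
  obtain u where u: "\<forall>x\<in>{p0,p1,p2,p3}. 0 \<le> u x" "sum u {p0,p1,p2,p3} = 1"
    "(\<Sum>x\<in>{p0,p1,p2,p3}. u x *\<^sub>R x) = y"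
    using assms(1) by (auto simp: convex_hull_finite)
  have s: "u p0 = 1 - u p1 - u p2 - u p3" using u(2) assms(2) by simp
  have "y = u p0 *\<^sub>R p0 + u p1 *\<^sub>R p1 + u p2 *\<^sub>R p2 + u p3 *\<^sub>R p3"
    using u(3) assms(2) by (simp add: add.assoc)
  then have "y = p0 + u p1 *\<^sub>R (p1 - p0) + u p2 *\<^sub>R (p2 - p0) + u p3 *\<^sub>R (p3 - p0)"
    unfolding s by (simp add: algebra_simps)
  then show thesis using that[of "u p1" "u p2" "u p3"] u(1) s by auto
qed

text \<open>Caratheodory's theorem with an affinely independent set of full dimension. A set of minimal
  cardinality whose hull contains \<open>y\<close> is affinely independent, since the theorem applies to it
  again.\<close>

lemma convex_hull_affine_basis:
  fixes E :: "(real^3) set"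
  assumes y: "y \<in> convex hull E" and d: "aff_dim E = 3"
  obtains T where "T \<subseteq> E" "card T = 4" "\<not> affine_dependent T" "y \<in> convex hull T"
proof -
  let ?Q = "\<lambda>S. finite S \<and> S \<subseteq> E \<and> y \<in> convex hull S"
  obtain S0 where "?Q S0" using y caratheodory[of E] by blast
  then obtain S where S: "?Q S" and min: "\<And>S'. ?Q S' \<Longrightarrow> card S \<le> card S'"
    using ex_has_least_nat[of ?Q S0 card] by blast
  obtain S' where S': "finite S'" "S' \<subseteq> S" "int (card S') \<le> aff_dim S + 1" "y \<in> convex hull S'"
    using S caratheodory_aff_dim[of S] by blast
  have "card S \<le> card S'" using min[of S'] S S' by auto
  then have "int (card S) \<le> aff_dim S + 1" using S'(3) by linarith
  moreover have "aff_dim S \<le> int (card S) - 1" using aff_dim_le_card S by blast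
  ultimately have ind: "\<not> affine_dependent S"
    using S by (simp add: affine_independent_iff_card)
  have "S \<subseteq> E" "S \<noteq> {}" using S by auto
  from extend_to_affine_basis_nonempty[OF ind this]
  obtain T where T: "\<not> affine_dependent T" "S \<subseteq> T" "T \<subseteq> E" "affine hull T = affine hull E"
    by blast
  have "int (card T) = aff_dim E + 1" using aff_dim_unique T by blast
  then have "card T = 4" using d by simp
  moreover have "y \<in> convex hull T" using S T(2) hull_mono by blast
  ultimately show thesis using that T by blast
qed

lemma integral_form_int_functional: "integral_form (int_functional F)"
proof -
  have "linear (int_functional F)" unfolding int_functional_def
    by (rule linearI) (simp_all add: sum_3 algebra_simps)
  then show ?thesis unfolding integral_form_def int_lattice_def int_functional_def
    by (auto intro!: Ints_sum Ints_mult)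
qed

lemma primitive_functional_nonzero:
  assumes "primitive F"
  obtains z where "int_functional F z \<noteq> 0"
proof -
  have "\<exists>i. F $ i \<noteq> 0"
  proof (rule ccontr)
    assume "\<nexists>i. F $ i \<noteq> 0"
    then have "range (($) F) = {0}" by auto
    then show False using assms unfolding primitive_def by simp
  qed
  then obtain i where i: "F $ i \<noteq> 0" by blast
  have "int_functional F (axis i 1) = of_int (F $ i)"
    unfolding int_functional_def by (simp add: axis_def if_distrib cong: if_cong)
  then show thesis using that[of "axis i 1"] i by simp
qed

lemma edge_cell_exists_unbalanced:
  assumes f: "integral_form f" "f p1 = f p0 + 1" "f p2 = f p0 + 1" "f p3 = f p0 + 1"
    and L: "{p0, p1, p2, p3} \<subseteq> int_lattice" and P: "convex P" "{p0, p1, p2, p3} \<subseteq> P"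
    and D: "\<not> affine_dependent {p0, p1, p2, p3}" "distinct [p0, p1, p2, p3]"
    and y: "y \<in> convex hull {p0, p1, p2, p3}"
  shows "\<exists>f a u v e. edge_cell P y f a u v e"
proof -
  obtain x1 x2 x3 where x: "0 \<le> x1" "0 \<le> x2" "0 \<le> x3" "x1 + x2 + x3 \<le> 1"
    "y = p0 + x1 *\<^sub>R (p1 - p0) + x2 *\<^sub>R (p2 - p0) + x3 *\<^sub>R (p3 - p0)"
    using simplex_coordinates[OF y D(2)] .
  show ?thesis unfolding x(5)
    using L P x(1-4) det3_affine_independent[OF D] f
    by (intro edge_cell_of_cone[OF f(1)]) (auto simp: integral_form_combination[OF f(1)] intro: int_lattice_diff)
qed

lemma edge_cell_exists_balanced:
  assumes f: "integral_form f" "f p1 = f p0" "f p2 = f p0 + 1" "f p3 = f p0 + 1"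
    and L: "{p0, p1, p2, p3} \<subseteq> int_lattice" and P: "{p0, p1, p2, p3} \<subseteq> P"
    and D: "\<not> affine_dependent {p0, p1, p2, p3}" "distinct [p0, p1, p2, p3]"
    and y: "y \<in> convex hull {p0, p1, p2, p3}"
  shows "\<exists>f a u v e. edge_cell P y f a u v e"
proof -
  let ?u = "p1 - p0" and ?v = "p3 - p2" and ?e = "p2 - p0"
  obtain x1 x2 x3 where x: "0 \<le> x1" "0 \<le> x2" "0 \<le> x3" "x1 + x2 + x3 \<le> 1"
    "y = p0 + x1 *\<^sub>R (p1 - p0) + x2 *\<^sub>R (p2 - p0) + x3 *\<^sub>R (p3 - p0)"
    using simplex_coordinates[OF y D(2)] .
  have "det3 ?u ?v ?e = - det3 (p1 - p0) (p2 - p0) (p3 - p0)"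
    by (simp add: det_3 vector_3 algebra_simps)
  then have "edge_frame f ?u ?v ?e" unfolding edge_frame_def
    using L det3_affine_independent[OF D] f
    by (auto simp: integral_form_combination[OF f(1)] intro: int_lattice_diff)
  moreover have eq: "y = p0 + x1 *\<^sub>R ?u + x3 *\<^sub>R ?v + (x2 + x3) *\<^sub>R ?e"
    unfolding x(5) by (simp add: algebra_simps)
  have "y \<in> edge_simplex p0 ?u ?v ?e 1" unfolding eq
    using x(1-4) by (intro edge_simplexI) auto
  ultimately show ?thesis using L P unfolding edge_cell_def by fastforce
qed

lemma edge_cell_exists:
  assumes P: "lattice_3_polytope P" "width_one P" and y: "y \<in> P"
  shows "\<exists>f a u v e. edge_cell P y f a u v e"
proof -
  obtain V where V: "finite V" "V \<subseteq> int_lattice" "P = convex hull V"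
    using P unfolding lattice_3_polytope_def lattice_polytope_def by blast
  obtain F c where F: "primitive F"
    and ht: "\<And>v. v extreme_point_of P \<Longrightarrow> int_functional F v = of_int c \<or> int_functional F v = of_int c + 1"
    using P(2) unfolding width_one_def by auto
  define E where "E = {x. x extreme_point_of P}"
  have EV: "E \<subseteq> V" unfolding E_def V(3) using extreme_point_of_convex_hull by blast
  have cP: "convex P" unfolding V(3) by (rule convex_convex_hull)
  have PE: "P = convex hull E" unfolding E_def
    using V by (intro Krein_Milman_Minkowski cP) (simp add: finite_imp_compact_convex_hull)
  have "aff_dim E = 3"
    using P(1) unfolding lattice_3_polytope_def by (metis PE aff_dim_convex_hull)
  then obtain T where T: "T \<subseteq> E" "card T = 4" "\<not> affine_dependent T" "y \<in> convex hull T"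
    using convex_hull_affine_basis[of y E] y PE by blast
  have TL: "T \<subseteq> int_lattice" using T(1) EV V(2) by blast
  have "E \<subseteq> P" unfolding E_def by (auto simp: extreme_point_of_def)
  then have TP: "T \<subseteq> P" using T(1) by blast
  have fin: "finite T" using T(2) by (intro card_ge_0_finite) simp
  define g where "g = int_functional F"
  have g: "integral_form g" unfolding g_def by (rule integral_form_int_functional)
  have g': "integral_form (\<lambda>x. - g x)"
    using g unfolding integral_form_def by (auto intro: linear_compose_neg)
  define A where "A = {p\<in>T. g p = of_int c}"
  define B where "B = {p\<in>T. g p = of_int c + 1}"
  have AB: "T = A \<union> B" "A \<inter> B = {}"
    using T(1) ht unfolding A_def B_def E_def g_def by auto
  have cAB: "card A + card B = 4" using T(2) AB fin
    by (metis card_Un_disjoint finite_Un)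
  \<comment> \<open>The four vertices cannot all lie in one lattice plane.\<close>
  have flat: False if "\<And>p. p \<in> T \<Longrightarrow> g p = h" for h
  proof -
    obtain p0 p1 p2 p3 where pT: "T = {p0,p1,p2,p3}" "distinct [p0,p1,p2,p3]"
      using T(2) by (auto simp: card_Suc_eq eval_nat_numeral)
    obtain z where z: "g z \<noteq> 0" using primitive_functional_nonzero[OF F] unfolding g_def .
    have "det3 (p1 - p0) (p2 - p0) (p3 - p0) \<noteq> 0"
      using det3_affine_independent pT T(3) by metis
    then obtain x1 x2 x3 where "z = x1 *\<^sub>R (p1 - p0) + x2 *\<^sub>R (p2 - p0) + x3 *\<^sub>R (p3 - p0)"
      using det3_coordinates by metis
    then show False using z that pT by (simp add: integral_form_combination[OF g])
  qed
  have "card A \<noteq> 0" "card B \<noteq> 0"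
    using flat[of "of_int c"] flat[of "of_int c + 1"] AB fin unfolding A_def B_def by auto
  then consider "card A = 1" "card B = 3" | "card A = 2" "card B = 2" | "card A = 3" "card B = 1"
    using cAB by linarith
  then show ?thesis
  proof cases
    case 1
    then obtain p0 p1 p2 p3 where p: "A = {p0}" "B = {p1,p2,p3}" "distinct [p1,p2,p3]"
      by (auto simp: card_1_singleton_iff card_3_iff)
    then have "T = {p0,p1,p2,p3}" "distinct [p0,p1,p2,p3]" using AB by auto
    moreover have "g p0 = of_int c" "g p1 = of_int c + 1" "g p2 = of_int c + 1" "g p3 = of_int c + 1"
      using p unfolding A_def B_def by auto
    ultimately show ?thesis
      using edge_cell_exists_unbalanced[OF g, of p1 p0 p2 p3 P y] cP TL TP T by simp
  next
    case 2
    then obtain p0 p1 p2 p3 where p: "A = {p0,p1}" "B = {p2,p3}" "p0 \<noteq> p1" "p2 \<noteq> p3"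
      by (auto simp: card_2_iff)
    then have "T = {p0,p1,p2,p3}" "distinct [p0,p1,p2,p3]" using AB by auto
    moreover have "g p0 = of_int c" "g p1 = of_int c" "g p2 = of_int c + 1" "g p3 = of_int c + 1"
      using p unfolding A_def B_def by auto
    ultimately show ?thesis
      using edge_cell_exists_balanced[OF g, of p1 p0 p2 p3 P y] TL TP T by simp
  next
    case 3
    then obtain p0 p1 p2 p3 where p: "B = {p0}" "A = {p1,p2,p3}" "distinct [p1,p2,p3]"
      by (auto simp: card_1_singleton_iff card_3_iff)
    then have "T = {p0,p1,p2,p3}" "distinct [p0,p1,p2,p3]" using AB by auto
    moreover have "g p0 = of_int c + 1" "g p1 = of_int c" "g p2 = of_int c" "g p3 = of_int c"
      using p unfolding A_def B_def by auto
    ultimately show ?thesis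
      using edge_cell_exists_unbalanced[OF g', of p1 p0 p2 p3 P y] cP TL TP T by simp
  qed
qed

section \<open>Covering the dilated polytope\<close>

lemma dilated_edge_simplex_subset:
  assumes P: "convex P" "{a, a + u, a + e, a + e + v} \<subseteq> P" and k: "0 < k"
  shows "edge_simplex (of_int k *\<^sub>R a) u v e k \<subseteq> (\<lambda>x. of_int k *\<^sub>R x) ` P"
proof
  fix z assume "z \<in> edge_simplex (of_int k *\<^sub>R a) u v e k"
  then obtain x y h where z: "z = of_int k *\<^sub>R a + x *\<^sub>R u + y *\<^sub>R v + h *\<^sub>R e"
      and b: "0 \<le> h" "h \<le> of_int k" "0 \<le> x" "x \<le> of_int k - h" "0 \<le> y" "y \<le> h"
    unfolding edge_simplex_def by blast
  define r where "r = (of_int k :: real)"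
  have r: "0 < r" unfolding r_def using k by simp
  have "((r - h - x) / r) *\<^sub>R a + (x / r) *\<^sub>R (a + u) + ((h - y) / r) *\<^sub>R (a + e)
      + (y / r) *\<^sub>R (a + e + v) \<in> P" (is "?w \<in> P")
    using P b r unfolding r_def[symmetric]
    by (intro convex_comb4) (auto simp: add_divide_distrib[symmetric])
  moreover have "z = r *\<^sub>R ?w"
    unfolding z r_def[symmetric] using r by (simp add: scaleR_add_right) (simp add: algebra_simps)
  ultimately show "z \<in> (\<lambda>x. of_int k *\<^sub>R x) ` P" unfolding r_def by blast
qed

lemma dilated_edge_simplex_mem:
  assumes "y \<in> edge_simplex a u v e 1" "0 < k"
  shows "of_int k *\<^sub>R y \<in> edge_simplex (of_int k *\<^sub>R a) u v e k"
proof -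
  obtain x z h where y: "y = a + x *\<^sub>R u + z *\<^sub>R v + h *\<^sub>R e"
    and b: "0 \<le> h" "h \<le> 1" "0 \<le> x" "x \<le> 1 - h" "0 \<le> z" "z \<le> h"
    using assms unfolding edge_simplex_def by auto
  define r where "r = (of_int k :: real)"
  have r: "0 < r" unfolding r_def using assms by simp
  have "r * x \<le> r * (1 - h)" "r * z \<le> r * h" using b r by (auto intro: mult_left_mono)
  then have "r *\<^sub>R a + (r * x) *\<^sub>R u + (r * z) *\<^sub>R v + (r * h) *\<^sub>R e \<in> edge_simplex (r *\<^sub>R a) u v e k"
    using b r by (intro edge_simplexI) (auto simp: r_def[symmetric] algebra_simps mult_left_le)
  then show ?thesis unfolding y r_def[symmetric] by (simp add: algebra_simps)
qed

theorem corollary1p8: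
  fixes P :: "(real^3) set" and k :: int
  assumes "lattice_3_polytope P"
    and "width_one P"
    and "k \<ge> 2"
  shows "\<exists>C. unimodular_cover C ((\<lambda>x. of_int k *\<^sub>R x) ` P)"
proof -
  let ?K = "(\<lambda>x. of_int k *\<^sub>R x) ` P"
  have cP: "convex P"
    using assms(1) unfolding lattice_3_polytope_def lattice_polytope_def by (auto simp: convex_convex_hull)
  then have cK: "convex ?K" by (rule convex_scaling)
  have "covered ?K (of_int k *\<^sub>R y)" if y: "y \<in> P" for y
  proof -
    obtain f a u v e where c: "edge_cell P y f a u v e" "lattice_primitive u" "lattice_primitive v"
      using edge_cell_exists[OF assms(1,2) y] edge_cell_primitive cP by blast
    then have F: "edge_frame f u v e" and a: "a \<in> int_lattice" "{a, a + u, a + e, a + e + v} \<subseteq> P"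
      "y \<in> edge_simplex a u v e 1" unfolding edge_cell_def by auto
    have k: "0 < k" using assms(3) by simp
    show ?thesis
      using edge_simplex_cover[OF F c(2,3) int_lattice_scale[OF a(1)] cK
          dilated_edge_simplex_subset[OF cP a(2) k] assms(3) dilated_edge_simplex_mem[OF a(3) k]] .
  qed
  then have "unimodular_cover {T. unimodular_tetrahedron T \<and> T \<subseteq> ?K} ?K"
    unfolding unimodular_cover_def covered_def by blast
  then show ?thesis by blast
qed

end
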